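(* Let $d\ge2$, put $n=d+1$, and write $x=(y,t)\in\mathbb{R}^d\times\mathbb{R}$. Every $O(d)$-equivariant homogeneous cubic polynomial mapping $P:\mathbb{R}^{d+1}\to\mathbb{R}^{d+1}$ has the form $$P(y,t)=\bigl((at^2+b|y|^2)y,\ ct^3+et|y|^2\bigr)$$ for some real constants $a,b,c,e$. Such a map is harmonic if and only if $$a+(d+2)b=0,\qquad 3c+de=0.$$ Consequently, every $O(d)$-equivariant homogeneous harmonic cubic is of the form $$P_{a,c}(y,t)=\left(a\Bigl(t^2-\frac{|y|^2}{d+2}\Bigr)y,\ c\Bigl(t^3-\frac3d\,t|y|^2\Bigr)\right).$$ Its Jacobian is $$J_{P_{a,c}}(y,t)=a^dc\left(t^2-\frac{|y|^2}{d+2}\right)^{d-1}\cdot\frac{3\bigl(d(d+2)t^4+6|y|^2t^2+3|y|^4\bigr)}{d(d+2)}.$$ The final factor is strictly positive away from the origin. Hence, no nontrivial map $P$ in this equivariant harmonic cubic class satisfies $J_P>0$ on $S^d$. More precisely: (i) if $n=d+1$ is odd and $ac\ne0$, then $J_{P_{a,c}}$ changes sign on $S^d$; (ii) if $n=d+1$ is even and $a^dc>0$, then $J_{P_{a,c}}\ge0$ on $\mathbb{R}^n$, but its zero set on $S^d$ consists of the two latitude spheres given by $|y|^2=(d+2)t^2$, $|y|^2+t^2=1$; (iii) every nontrivial member of this equivariant class either has identically zero Jacobian or has a nonzero differential at some point where its Jacobian vanishes. In particular, none is quasiregular, and none is one-to-one when $d\ge2$ and $ac\ne0$.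
   Context: $O(d)$ acts on $\mathbb{R}^d\times\mathbb{R}$ by $R\cdot(y,t)=(Ry,t)$, on both domain and target; $P$ is $O(d)$-equivariant if $P(R\cdot x)=R\cdot P(x)$ for all $R\in O(d)$. Homogeneous cubic means that all components are homogeneous polynomials of degree $3$; harmonic means that all components are harmonic for the Euclidean Laplacian on $\mathbb{R}^{d+1}$. $J_P=\det DP$; $S^d$ is the unit sphere of $\mathbb{R}^{d+1}$; nontrivial means not identically zero. A nonconstant mapping $f:\mathbb{R}^n\to\mathbb{R}^n$ is sense-preserving quasiregular if $f\in W^{1,n}_{\mathrm{loc}}$, $J_f\ge0$ a.e., and $\|Df\|^n\le KJ_f$ a.e. for some finite $K$ (operator norm); quasiregular means that $f$ or its composition with a reflection of the target has this property. *)

theory Defs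
  imports "HOL-Analysis.Analysis"
begin

text \<open>
  For \<open>d = CARD('d)\<close>, the space of pairs \<open>(y, t)\<close> with \<open>y\<close> in d-space and \<open>t\<close> real is
  rendered as \<open>real ^ ('d option)\<close>, so that the library's Euclidean norm and determinant
  apply: the index \<open>Some i\<close> carries the i-th coordinate of \<open>y\<close> and \<open>None\<close> carries \<open>t\<close>.
\<close>

definition join :: "real ^ 'd \<Rightarrow> real \<Rightarrow> real ^ (('d::finite) option)" where
  "join y t = (\<chi> j. case j of Some i \<Rightarrow> y $ i | None \<Rightarrow> t)"

definition ycoord :: "real ^ (('d::finite) option) \<Rightarrow> real ^ 'd" where
  "ycoord x = (\<chi> i. x $ Some i)"

definition tcoord :: "real ^ (('d::finite) option) \<Rightarrow> real" where
  "tcoord x = x $ None"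

lemma ycoord_join [simp]: "ycoord (join y t) = y"
  by (simp add: ycoord_def join_def vec_eq_iff)

lemma tcoord_join [simp]: "tcoord (join y t) = t"
  by (simp add: tcoord_def join_def)

lemma join_coords [simp]: "join (ycoord x) (tcoord x) = x"
  by (simp add: ycoord_def tcoord_def join_def vec_eq_iff split: option.split)

definition act :: "real ^ 'd ^ 'd \<Rightarrow> real ^ (('d::finite) option) \<Rightarrow> real ^ (('d::finite) option)" where
  "act R x = join (R *v ycoord x) (tcoord x)"

definition equivariant :: "(real ^ (('d::finite) option) \<Rightarrow> real ^ (('d::finite) option)) \<Rightarrow> bool" where
  "equivariant P \<longleftrightarrow> (\<forall>R. orthogonal_matrix R \<longrightarrow> (\<forall>x. P (act R x) = act R (P x)))"

text \<open>
  The functions \<open>\<alpha>\<close> are multi-indices; there are only finitely many of a given total degree.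
  The zero polynomial is homogeneous of every degree.
\<close>

definition homogeneous_poly :: "nat \<Rightarrow> (real ^ 'n \<Rightarrow> real) \<Rightarrow> bool" where
  "homogeneous_poly k f \<longleftrightarrow>
     (\<exists>c :: ('n \<Rightarrow> nat) \<Rightarrow> real. \<forall>x.
        f x = (\<Sum>\<alpha> | (\<Sum>i\<in>UNIV. \<alpha> i) = k. c \<alpha> * (\<Prod>i\<in>UNIV. (x $ i) ^ \<alpha> i)))"

definition homogeneous_cubic :: "(real ^ 'n \<Rightarrow> real ^ 'm) \<Rightarrow> bool" where
  "homogeneous_cubic P \<longleftrightarrow> (\<forall>j. homogeneous_poly 3 (\<lambda>x. P x $ j))"

definition pd :: "'a::euclidean_space \<Rightarrow> ('a \<Rightarrow> real) \<Rightarrow> 'a \<Rightarrow> real" where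
  "pd b f x = frechet_derivative f (at x) b"

text \<open>
  The value of \<^const>\<open>frechet_derivative\<close> is unspecified where a function is not
  differentiable; the following predicate, k-fold continuous differentiability, excludes this.
\<close>

primrec Ck :: "nat \<Rightarrow> ('a::euclidean_space \<Rightarrow> real) \<Rightarrow> bool" where
  "Ck 0 f \<longleftrightarrow> continuous_on UNIV f"
| "Ck (Suc k) f \<longleftrightarrow> (\<forall>x. f differentiable (at x)) \<and> (\<forall>b\<in>Basis. Ck k (pd b f))"

definition laplacian :: "('a::euclidean_space \<Rightarrow> real) \<Rightarrow> 'a \<Rightarrow> real" where
  "laplacian f x = (\<Sum>b\<in>Basis. pd b (pd b f) x)"

definition harmonic_fun :: "('a::euclidean_space \<Rightarrow> real) \<Rightarrow> bool" where
  "harmonic_fun f \<longleftrightarrow> Ck 2 f \<and> (\<forall>x. laplacian f x = 0)"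

definition harmonic_map :: "('a::euclidean_space \<Rightarrow> real ^ 'm) \<Rightarrow> bool" where
  "harmonic_map P \<longleftrightarrow> (\<forall>j. harmonic_fun (\<lambda>x. P x $ j))"

definition jac :: "(real ^ 'n \<Rightarrow> real ^ 'n) \<Rightarrow> real ^ 'n \<Rightarrow> real" where
  "jac P x = det (jacobian P (at x))"

definition equiv_cubic ::
    "real \<Rightarrow> real \<Rightarrow> real \<Rightarrow> real \<Rightarrow> real ^ (('d::finite) option) \<Rightarrow> real ^ (('d::finite) option)" where
  "equiv_cubic a b c e x =
     (let y = ycoord x; t = tcoord x in
        join ((a * t\<^sup>2 + b * (norm y)\<^sup>2) *\<^sub>R y) (c * t ^ 3 + e * t * (norm y)\<^sup>2))"

definition harm_cubic :: "real \<Rightarrow> real \<Rightarrow> real ^ (('d::finite) option) \<Rightarrow> real ^ (('d::finite) option)" where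
  "harm_cubic a c x =
     (let y = ycoord x; t = tcoord x; d = real CARD('d) in
        join ((a * (t\<^sup>2 - (norm y)\<^sup>2 / (d + 2))) *\<^sub>R y)
             (c * (t ^ 3 - 3 / d * t * (norm y)\<^sup>2)))"

definition eqv_harm_cubic :: "(real ^ (('d::finite) option) \<Rightarrow> real ^ (('d::finite) option)) \<Rightarrow> bool" where
  "eqv_harm_cubic P \<longleftrightarrow> equivariant P \<and> homogeneous_cubic P \<and> harmonic_map P"

definition test_function :: "('a::euclidean_space \<Rightarrow> real) \<Rightarrow> bool" where
  "test_function \<phi> \<longleftrightarrow> (\<forall>k. Ck k \<phi>) \<and> compact (closure (support_on UNIV \<phi>))"

definition locally_Lp :: "nat \<Rightarrow> ('a::euclidean_space \<Rightarrow> 'b::euclidean_space) \<Rightarrow> bool" where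
  "locally_Lp p f \<longleftrightarrow> f \<in> borel_measurable lebesgue \<and>
     (\<forall>S. compact S \<longrightarrow> set_integrable lebesgue S (\<lambda>x. norm (f x) ^ p))"

definition weak_derivative ::
    "(real ^ 'n \<Rightarrow> real ^ 'm) \<Rightarrow> (real ^ 'n \<Rightarrow> real ^ 'n ^ 'm) \<Rightarrow> bool" where
  "weak_derivative f G \<longleftrightarrow>
     (\<forall>\<phi>. test_function \<phi> \<longrightarrow> (\<forall>i j.
        (LINT x|lebesgue. f x $ i * pd (axis j 1) \<phi> x) =
        - (LINT x|lebesgue. G x $ i $ j * \<phi> x)))"

text \<open>
  \<open>G\<close> is the weak differential, unique up to null sets; the first three conditions on it say
  that \<open>f\<close> lies in the local Sobolev space of order 1 and exponent \<open>n = CARD('n)\<close>.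
\<close>

definition sense_preserving_quasiregular :: "(real ^ 'n \<Rightarrow> real ^ 'n) \<Rightarrow> bool" where
  "sense_preserving_quasiregular f \<longleftrightarrow>
     \<not> f constant_on UNIV \<and>
     (\<exists>G. locally_Lp CARD('n) f \<and> locally_Lp CARD('n) G \<and> weak_derivative f G \<and>
        (AE x in lebesgue. det (G x) \<ge> 0) \<and>
        (\<exists>K. AE x in lebesgue. onorm ((*v) (G x)) ^ CARD('n) \<le> K * det (G x)))"

definition hyperplane_reflection :: "'a::euclidean_space \<Rightarrow> 'a \<Rightarrow> 'a" where
  "hyperplane_reflection v x = x - (2 * (x \<bullet> v)) *\<^sub>R v"

definition quasiregular :: "(real ^ 'n \<Rightarrow> real ^ 'n) \<Rightarrow> bool" where
  "quasiregular f \<longleftrightarrow> sense_preserving_quasiregular f \<or>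
     (\<exists>v. norm v = 1 \<and> sense_preserving_quasiregular (hyperplane_reflection v \<circ> f))"

end

theory Submission
  imports Defs
begin

text \<open>
  Equivariance determines a cubic from its values on the plane spanned by one \<open>y\<close>-axis and the
  \<open>t\<close>-axis, where it is a pair of binary cubics with parity restrictions. It also makes the Jacobian
  invariant, and on that plane the differential is a multiple of the identity apart from one
  2-by-2 block. On the cone \<open>|y|\<^sup>2 = (d + 2) t\<^sup>2\<close> the \<open>y\<close>-component vanishes: there the Jacobian
  is zero (as \<open>d \<ge> 2\<close>) and injectivity fails. The differential is nonzero at points of the cone where
  the map is nonzero, by Euler's identity. This excludes quasiregularity, because the weak differential of a
  smooth map agrees almost everywhere with the classical one, and by continuity the distortion
  inequality then holds at every point.
\<close>

section \<open>Iterated differentiability\<close>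

text \<open>Quasiregularity asks only for the existence of some weak differential \<open>G\<close>,
  so refuting it means controlling every candidate \<open>G\<close>. That calls for the fundamental
  lemma of the calculus of variations, hence for enough compactly supported smooth functions; these
  are built from exp(-1/s). The cone is where the number a t^2 + b |y|^2 vanishes. For nonzero y
  this is the eigenvalue of the differential on the d - 1 directions orthogonal to y and to the
  t-axis, which explains both the power d - 1 in the Jacobian and the need for d >= 2. The critical
  point with nonzero value is found in two ways. If a c is nonzero, a cone point with t = 1 has
  t-component c (1 - 3 (d + 2) / d), which is nonzero because 3 (d + 2) > d. If a c = 0, the factor
  a^d c makes the Jacobian vanish identically, and any point where the map is nonzero will do. So
  the second alternative in (iii) holds for every nontrivial member.\<close>

lemma pd_eq: "(f has_derivative D) (at x) \<Longrightarrow> pd b f x = D b"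
  by (simp add: pd_def frechet_derivative_at[symmetric])

lemma pd_has_derivative:
  "f differentiable (at x) \<Longrightarrow> (f has_derivative (\<lambda>b. pd b f x)) (at x)"
  unfolding pd_def by (metis frechet_derivative_works)

lemma pd_const [simp]: "pd b (\<lambda>x. c) = (\<lambda>x. 0)"
  by (rule ext, rule pd_eq) (auto intro!: derivative_eq_intros)

lemma pd_add:
  assumes "\<And>x. f differentiable (at x)" "\<And>x. g differentiable (at x)"
  shows "pd b (\<lambda>x. f x + g x) = (\<lambda>x. pd b f x + pd b g x)"
  by (rule ext, rule pd_eq) (intro has_derivative_add pd_has_derivative assms)

lemma pd_mult:
  assumes "\<And>x. f differentiable (at x)" "\<And>x. g differentiable (at x)"
  shows "pd b (\<lambda>x. f x * g x) = (\<lambda>x. f x * pd b g x + pd b f x * g x)"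
  by (rule ext, rule pd_eq) (intro has_derivative_mult pd_has_derivative assms)

lemma Ck_mono1: "Ck (Suc k) f \<Longrightarrow> Ck k f"
proof (induction k arbitrary: f)
  case 0
  then show ?case
    by (auto intro!: continuous_at_imp_continuous_on differentiable_imp_continuous_within)
next
  case (Suc k)
  then show ?case by (metis Ck.simps(2))
qed

lemma Ck_mono: "Ck k f \<Longrightarrow> j \<le> k \<Longrightarrow> Ck j f"
  by (induction k) (auto simp: le_Suc_eq dest: Ck_mono1 simp del: Ck.simps(2))

lemma Ck_continuous_on: "Ck k f \<Longrightarrow> continuous_on S f"
  using Ck_mono[of k f 0] by (auto intro: continuous_on_subset)

lemma Ck_const [intro]: "Ck k (\<lambda>x. c)"
  by (induction k arbitrary: c) auto

lemma Ck_add [intro]: "Ck k f \<Longrightarrow> Ck k g \<Longrightarrow> Ck k (\<lambda>x. f x + g x)"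
  by (induction k arbitrary: f g) (auto intro: continuous_intros simp: pd_add)

lemma Ck_mult [intro]: "Ck k f \<Longrightarrow> Ck k g \<Longrightarrow> Ck k (\<lambda>x. f x * g x)"
proof (induction k arbitrary: f g)
  case 0
  then show ?case by (auto intro: continuous_intros)
next
  case (Suc k)
  have "Ck k f" "Ck k g" using Suc.prems by (auto intro: Ck_mono1 simp del: Ck.simps)
  with Suc show ?case by (auto simp: pd_mult)
qed

lemma Ck_cmult: "Ck k f \<Longrightarrow> Ck k (\<lambda>x. c * f x)"
  by (intro Ck_mult Ck_const)

lemma Ck_diff [intro]: "Ck k f \<Longrightarrow> Ck k g \<Longrightarrow> Ck k (\<lambda>x. f x - g x)"
  using Ck_add[of k f "\<lambda>x. (-1) * g x"] Ck_cmult[of k g "-1"] by simp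

lemma Ck_power [intro]: "Ck k f \<Longrightarrow> Ck k (\<lambda>x. f x ^ m)"
  by (induction m) auto

lemma Ck_sum [intro]: "(\<And>i. i \<in> I \<Longrightarrow> Ck k (f i)) \<Longrightarrow> Ck k (\<lambda>x. \<Sum>i\<in>I. f i x)"
  by (induction I rule: infinite_finite_induct) auto

lemma Ck_prod [intro]: "(\<And>i. i \<in> I \<Longrightarrow> Ck k (f i)) \<Longrightarrow> Ck k (\<lambda>x. \<Prod>i\<in>I. f i x)"
  by (induction I rule: infinite_finite_induct) auto

lemma Ck_inner [intro]: "Ck k (\<lambda>x. x \<bullet> v)"
proof (cases k)
  case 0 then show ?thesis by (auto intro: continuous_intros)
next
  case (Suc j)
  have D: "((\<lambda>x. x \<bullet> v) has_derivative (\<lambda>h. h \<bullet> v)) (at x)" for x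
    by (auto intro!: derivative_eq_intros)
  have "pd b (\<lambda>x. x \<bullet> v) = (\<lambda>x. b \<bullet> v)" for b
    by (rule ext, rule pd_eq, rule D)
  with Suc D show ?thesis by (auto simp: differentiable_def intro: Ck_const)
qed

lemma Ck_component [intro]: "Ck k (\<lambda>x::real^'n. x $ i)"
  using Ck_inner[of k "axis i 1 :: real^'n"] by (simp add: inner_axis)

text \<open>The derivatives of \<open>exp (- 1 / s)\<close> are combinations of the members of this family.\<close>

definition flat :: "nat \<Rightarrow> real \<Rightarrow> real" where
  "flat m s = (if s \<le> 0 then 0 else exp (- inverse s) * inverse s ^ m)"

text \<open>With u = 1/s the limit from the right is that of u^m / exp u at infinity; from the left
  the function is zero.\<close>

lemma flat_tendsto_0: "(flat m \<longlongrightarrow> 0) (at 0)"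
proof -
  have "((\<lambda>s. inverse s ^ m / exp (inverse s)) \<longlongrightarrow> (0::real)) (at_right 0)"
    by (rule filterlim_compose[OF tendsto_power_div_exp_0 filterlim_inverse_at_top_right])
  then have "(flat m \<longlongrightarrow> 0) (at_right 0)"
    by (rule Lim_transform_eventually)
       (auto simp: flat_def eventually_at_filter exp_minus field_simps)
  moreover have "(flat m \<longlongrightarrow> 0) (at_left 0)"
    by (rule tendsto_eventually) (auto simp: flat_def eventually_at_filter)
  ultimately show ?thesis by (simp add: filterlim_split_at)
qed

lemma flat_has_derivative:
  "(flat m has_real_derivative flat (m + 2) s - real m * flat (m + 1) s) (at s)"
proof (cases s "0::real" rule: linorder_cases)
  case less
  have "((\<lambda>s. 0) has_real_derivative 0) (at s)" by simp
  then have "(flat m has_real_derivative 0) (at s)"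
    by (rule has_field_derivative_transform_within_open[of _ _ _ "{..<0}"])
       (use less in \<open>auto simp: flat_def\<close>)
  then show ?thesis using less by (simp add: flat_def)
next
  case equal
  have "((\<lambda>h. (flat m h - flat m 0) / (h - 0)) \<longlongrightarrow> 0) (at 0)"
    \<comment> \<open>The difference quotient of \<open>flat m\<close> at 0 is
      \<open>flat (Suc m)\<close> itself.\<close>
    by (rule Lim_transform_eventually[OF flat_tendsto_0[of "Suc m"]])
       (auto simp: flat_def eventually_at_filter field_simps)
  then show ?thesis using equal by (simp add: has_field_derivative_iff flat_def)
next
  case greater
  have "((\<lambda>s. exp (- inverse s) * inverse s ^ m) has_real_derivative
     flat (m + 2) s - real m * flat (m + 1) s) (at s)"
    using greater
    apply (auto intro!: derivative_eq_intros simp: flat_def)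
    \<comment> \<open>The power rule produces the exponent m - 1, so m = 0 has to be simplified
      separately.\<close>
    apply (cases m; simp add: power2_eq_square field_simps)
    done
  then show ?thesis
    by (rule has_field_derivative_transform_within_open[of _ _ _ "{0<..}"])
       (use greater in \<open>auto simp: flat_def\<close>)
qed

text \<open>The induction runs over all m at once: a partial derivative is a constant times a
  combination of \<open>flat (m + 2)\<close> and \<open>flat (m + 1)\<close> of the same affine
  form.\<close>

lemma Ck_flat_affine: "Ck k (\<lambda>x. flat m (x \<bullet> v + c))"
proof (induction k arbitrary: m)
  case 0
  have "continuous_on UNIV (flat m)"
    by (intro continuous_at_imp_continuous_on ballI DERIV_isCont[OF flat_has_derivative])
  then show ?case
    by (auto intro!: continuous_on_compose2[of UNIV "flat m"] continuous_intros)
next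
  case (Suc k)
  let ?D = "\<lambda>s. flat (m + 2) s - real m * flat (m + 1) s"
  have D: "((\<lambda>x. flat m (x \<bullet> v + c)) has_derivative (\<lambda>h. (h \<bullet> v) * ?D (x \<bullet> v + c))) (at x)" for x
  proof -
    have "((\<lambda>x. x \<bullet> v + c) has_derivative (\<lambda>h. h \<bullet> v)) (at x)"
      by (auto intro!: derivative_eq_intros)
    from has_derivative_compose[OF this flat_has_derivative[unfolded has_field_derivative_def]]
    show ?thesis by (simp add: mult.commute)
  qed
  have "pd b (\<lambda>x. flat m (x \<bullet> v + c)) = (\<lambda>x. (b \<bullet> v) * ?D (x \<bullet> v + c))" for b
    by (rule ext, rule pd_eq, rule D)
  moreover have "Ck k (\<lambda>x. (b \<bullet> v) * ?D (x \<bullet> v + c))" for b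
    by (intro Ck_cmult Ck_diff Suc)
  ultimately show ?case using D by (auto simp: differentiable_def)
qed

lemma flat_bounds: "0 \<le> flat 0 s" "flat 0 s \<le> 1"
  by (auto simp: flat_def)

text \<open>For s > 0 the value is exp(-1/(k s)), whose exponent tends to 0. Rescaling thus sharpens
  the cut-off into the indicator of the open half-line.\<close>

lemma flat_tendsto_indicator:
  "(\<lambda>k. flat 0 (real k * s)) \<longlonglongrightarrow> (if s > 0 then 1 else 0)"
proof (cases "s > 0")
  case True
  have "(\<lambda>k. exp (- (inverse s * inverse (real k)))) \<longlonglongrightarrow> exp (- (inverse s * 0))"
    by (intro tendsto_intros tendsto_exp tendsto_minus tendsto_mult lim_inverse_n)
  moreover have "\<forall>\<^sub>F k in sequentially. exp (- (inverse s * inverse (real k))) = flat 0 (real k * s)"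
    using eventually_gt_at_top[of 0]
    by eventually_elim (use True in \<open>auto simp: flat_def mult_le_0_iff\<close>)
  ultimately show ?thesis using True by (auto intro: Lim_transform_eventually)
next
  case False
  then have "real k * s \<le> 0" for k by (simp add: mult_nonneg_nonpos)
  then show ?thesis using False by (auto simp: flat_def)
qed

section \<open>Integration by parts against test functions\<close>

lemma lborel_integral_translation:
  fixes f :: "'a::euclidean_space \<Rightarrow> real"
  assumes "f \<in> borel_measurable borel"
  shows "(LINT x|lborel. f (v + x)) = (LINT x|lborel. f x)"
proof -
  have "(LINT x|lborel. f x) = (LINT x|distr lborel borel ((+) v). f x)"
    by (simp add: lborel_distr_plus)
  also have "\<dots> = (LINT x|lborel. f (v + x))"
    by (rule integral_distr) (use assms in auto)
  finally show ?thesis by simp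
qed

lemma integrable_continuous_bounded_support:
  fixes f :: "'a::euclidean_space \<Rightarrow> real"
  assumes "continuous_on UNIV f" "\<And>x. norm x > R \<Longrightarrow> f x = 0"
  shows "integrable lborel f"
proof -
  have "integrable lborel (\<lambda>x. indicator (cball 0 R) x *\<^sub>R f x)"
    using borel_integrable_compact[of "cball 0 R" f] assms(1)
    by (auto intro: continuous_on_subset)
  moreover have "(\<lambda>x. indicator (cball 0 R) x *\<^sub>R f x) = f"
    using assms(2) by (auto simp: fun_eq_iff indicator_def)
  ultimately show ?thesis by simp
qed

text \<open>By translation invariance the difference quotients have integral zero; pass to the limit.\<close>

lemma integral_pd_eq_0:
  fixes f :: "'a::euclidean_space \<Rightarrow> real"
  assumes f: "Ck 1 f" and supp: "\<And>x. norm x > R \<Longrightarrow> f x = 0" and b: "norm b = 1" "b \<in> Basis"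
  shows "(LINT x|lborel. pd b f x) = 0"
proof -
  have cont: "continuous_on UNIV f" by (rule Ck_continuous_on[OF f])
  have diff: "f differentiable (at x)" for x using f by simp
  have cpd: "continuous_on S (pd b f)" for S
    using f b by (auto intro: continuous_on_subset)
  define q where "q k x = real (Suc k) * (f (inverse (real (Suc k)) *\<^sub>R b + x) - f x)" for k x
  have int: "integrable lborel f"
    by (rule integrable_continuous_bounded_support[OF cont supp])
  have cont_shift: "continuous_on UNIV (\<lambda>x. f (v + x))" for v :: 'a
    by (auto intro!: continuous_on_compose2[OF cont] continuous_intros)
  have int_shift: "integrable lborel (\<lambda>x. f (v + x))" for v :: 'a
  proof (rule integrable_continuous_bounded_support[OF cont_shift, of "R + norm v"])
    fix x :: 'a assume "R + norm v < norm x"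
    then have "R < norm (v + x)" using norm_triangle_ineq4[of "v + x" v] by simp
    then show "f (v + x) = 0" by (rule supp)
  qed
  have q0: "(LINT x|lborel. q k x) = 0" for k
    unfolding q_def using int int_shift lborel_integral_translation[of f]
      borel_measurable_continuous_onI[OF cont] by simp
  have der: "((\<lambda>s. f (s *\<^sub>R b + x)) has_real_derivative pd b f (s *\<^sub>R b + x)) (at s)" for s x
  proof -
    have "((\<lambda>s. s *\<^sub>R b + x) has_derivative (\<lambda>h. h *\<^sub>R b)) (at s)"
      by (auto intro!: derivative_eq_intros)
    from has_derivative_compose[OF this pd_has_derivative[OF diff]]
    have "((\<lambda>s. f (s *\<^sub>R b + x)) has_derivative (\<lambda>h. pd (h *\<^sub>R b) f (s *\<^sub>R b + x))) (at s)" .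
    moreover have "pd (h *\<^sub>R b) f z = h * pd b f z" for h z
      using linear_cmul[OF has_derivative_linear[OF pd_has_derivative[OF diff]]]
      by simp
    ultimately show ?thesis by (simp add: has_field_derivative_def mult_commute_abs)
  qed
  have lim: "(\<lambda>k. q k x) \<longlonglongrightarrow> pd b f x" for x
  proof -
    have "((\<lambda>h. (f (h *\<^sub>R b + x) - f x) / h) \<longlongrightarrow> pd b f x) (at 0)"
      using der[of x 0] by (simp add: has_field_derivative_iff)
    moreover have "filterlim (\<lambda>k. inverse (real (Suc k))) (at 0) sequentially"
      using LIMSEQ_inverse_real_of_nat by (auto simp: filterlim_at)
    ultimately have "(\<lambda>k. (f (inverse (real (Suc k)) *\<^sub>R b + x) - f x) / inverse (real (Suc k)))
        \<longlonglongrightarrow> pd b f x"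
      by (rule filterlim_compose)
    then show ?thesis by (simp add: q_def field_simps)
  qed
  obtain M where M: "\<And>x. norm x \<le> R + 2 \<Longrightarrow> \<bar>pd b f x\<bar> \<le> M"
    using compact_imp_bounded[OF compact_continuous_image[OF cpd, of "cball 0 (R + 2)"]]
    by (force simp: bounded_iff)
  \<comment> \<open>The dominating function: steps have length at most 1, so \<open>q k\<close>
    vanishes beyond radius R + 1; inside, the mean value theorem makes it a derivative at a point of
    norm at most R + 2, where \<open>M\<close> is a bound.\<close>
  let ?w = "\<lambda>x::'a. indicator (cball 0 (R + 1)) x *\<^sub>R M"
  have qw: "norm (q k x) \<le> ?w x" for k x
  proof -
    let ?h = "inverse (real (Suc k))"
    have h: "0 < ?h" "?h \<le> 1" by (auto simp: field_simps)
    show ?thesis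
    proof (cases "norm x \<le> R + 1")
      case True
      obtain z where z: "0 < z" "z < ?h" "f (?h *\<^sub>R b + x) - f (0 *\<^sub>R b + x) = (?h - 0) * pd b f (z *\<^sub>R b + x)"
        using MVT2[OF h(1), of "\<lambda>s. f (s *\<^sub>R b + x)" "\<lambda>s. pd b f (s *\<^sub>R b + x)"] der by blast
      have "norm (z *\<^sub>R b + x) \<le> R + 2"
        using norm_triangle_ineq[of "z *\<^sub>R b" x] z h True b by simp
      then have "\<bar>pd b f (z *\<^sub>R b + x)\<bar> \<le> M" by (rule M)
      moreover have "q k x = pd b f (z *\<^sub>R b + x)"
        using z(3) by (simp add: q_def)
      ultimately show ?thesis using True by simp
    next
      case False
      then have "f x = 0" by (auto intro: supp)
      moreover have "R < norm (?h *\<^sub>R b + x)"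
        using norm_triangle_ineq4[of "?h *\<^sub>R b + x" "?h *\<^sub>R b"] h False b by simp
      ultimately show ?thesis using False supp by (simp add: q_def)
    qed
  qed
  have "(\<lambda>k. LINT x|lborel. q k x) \<longlonglongrightarrow> (LINT x|lborel. pd b f x)"
  proof (rule integral_dominated_convergence[where w = ?w])
    show "pd b f \<in> borel_measurable lborel"
      using cpd by (simp add: borel_measurable_continuous_onI)
    show "q k \<in> borel_measurable lborel" for k
      unfolding q_def
      by (auto intro!: borel_measurable_continuous_onI continuous_intros cont cont_shift)
    show "integrable lborel ?w"
      using borel_integrable_compact[of "cball (0::'a) (R + 1)" "\<lambda>_. M"]
      by simp
  qed (use lim qw in auto)
  then show ?thesis by (simp add: q0 LIMSEQ_const_iff)
qed

section \<open>Test functions determine a locally integrable function\<close>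

lemma locally_Lp_integrable:
  fixes f :: "'a::euclidean_space \<Rightarrow> 'b::euclidean_space"
  assumes "locally_Lp p f" "p \<ge> 1" "compact S"
  shows "set_integrable lebesgue S f"
proof -
  have m: "f \<in> borel_measurable lebesgue" and i: "set_integrable lebesgue S (\<lambda>x. norm (f x) ^ p)"
    using assms by (auto simp: locally_Lp_def)
  have S: "S \<in> sets lebesgue" using assms(3) by (simp add: borel_compact)
  have i1: "set_integrable lebesgue S (\<lambda>x. 1::real)"
    using assms(3) lmeasurable_compact[of S]
    by (auto simp: set_integrable_def fmeasurable_def intro: integrable_real_indicator simp del: integrable_indicator_iff)
  have i2: "integrable lebesgue (\<lambda>x. indicator S x *\<^sub>R (1 + norm (f x) ^ p))"
    using set_integral_add(1)[OF i1 i] by (simp add: set_integrable_def)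
  have m2: "(\<lambda>x. indicator S x *\<^sub>R f x) \<in> borel_measurable lebesgue"
    using m S by measurable
  \<comment> \<open>Compact sets have finite measure, so this pointwise bound passes from exponent p
    to exponent 1.\<close>
  have "norm (f x) \<le> 1 + norm (f x) ^ p" for x
  proof (cases "norm (f x) \<le> 1")
    case True
    then show ?thesis by (simp add: add_increasing2)
  next
    case False
    then have "norm (f x) ^ 1 \<le> norm (f x) ^ p" by (intro power_increasing assms) auto
    then show ?thesis by simp
  qed
  then show ?thesis
    unfolding set_integrable_def
    by (intro Bochner_Integration.integrable_bound[OF i2 m2]) (auto simp: indicator_def)
qed

text \<open>Each factor is a cut-off of an affine form, hence smooth; the product vanishes off the
  open box and tends to its indicator as k grows. Boxes are chosen because they generate the Borel
  sets and are closed under intersection.\<close>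

definition box_bump :: "nat \<Rightarrow> 'a \<Rightarrow> 'a \<Rightarrow> 'a::euclidean_space \<Rightarrow> real" where
  "box_bump k a b x = (\<Prod>i\<in>Basis. flat 0 (real k * (x \<bullet> i - a \<bullet> i)) * flat 0 (real k * (b \<bullet> i - x \<bullet> i)))"

lemma box_bump_bounds: "0 \<le> box_bump k a b x" "box_bump k a b x \<le> 1"
  unfolding box_bump_def
  by (auto intro!: prod_nonneg prod_le_1 mult_nonneg_nonneg mult_le_one flat_bounds)

lemma box_bump_eq_0: "x \<notin> box a b \<Longrightarrow> box_bump k a b x = 0"
  unfolding box_bump_def mem_box
  by (rule prod_zero) (auto simp: flat_def not_less intro!: mult_nonneg_nonpos)

lemma box_bump_tendsto: "(\<lambda>k. box_bump k a b x) \<longlonglongrightarrow> indicator (box a b) x"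
proof -
  have "(\<lambda>k. box_bump k a b x) \<longlonglongrightarrow>
    (\<Prod>i\<in>Basis. (if x \<bullet> i - a \<bullet> i > 0 then 1 else 0) * (if b \<bullet> i - x \<bullet> i > 0 then 1 else 0))"
    unfolding box_bump_def by (intro tendsto_prod tendsto_mult flat_tendsto_indicator)
  also have "(\<Prod>i\<in>Basis. (if x \<bullet> i - a \<bullet> i > 0 then 1 else 0) * (if b \<bullet> i - x \<bullet> i > 0 then 1 else 0))
      = (indicator (box a b) x :: real)"
    by (auto simp: indicator_def mem_box intro!: prod.neutral)
  finally show ?thesis .
qed

lemma test_function_box_bump: "test_function (box_bump k a b)"
proof -
  have "Ck m (box_bump k a b)" for m
  proof -
    have "Ck m (\<lambda>x. flat 0 (x \<bullet> (real k *\<^sub>R i) + - (real k * (a \<bullet> i))) *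
        flat 0 (x \<bullet> (- (real k *\<^sub>R i)) + real k * (b \<bullet> i)))" for i
      by (intro Ck_mult Ck_flat_affine)
    then show ?thesis
      unfolding box_bump_def by (intro Ck_prod) (simp add: algebra_simps)
  qed
  moreover have "support_on UNIV (box_bump k a b) \<subseteq> cbox a b"
    using box_bump_eq_0 box_subset_cbox by (fastforce simp: support_on_def)
  then have "compact (closure (support_on UNIV (box_bump k a b)))"
    by (meson bounded_cbox bounded_subset compact_closure)
  ultimately show ?thesis by (simp add: test_function_def)
qed

lemma test_function_bounded_support:
  assumes "test_function \<phi>"
  shows "\<exists>R. \<forall>x. norm x > R \<longrightarrow> \<phi> x = 0"
proof -
  have "bounded (support_on UNIV \<phi>)"
    using assms by (auto simp: test_function_def intro: bounded_subset[OF compact_imp_bounded closure_subset])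
  then show ?thesis
    by (force simp: bounded_iff support_on_def not_le[symmetric])
qed

text \<open>Dynkin's argument: the sets over which \<open>f\<close> integrates to zero contain an
  intersection-stable generator and are closed under complements and countable disjoint unions, so
  they are all Borel sets.\<close>

lemma AE_eq_0_of_box_integrals:
  fixes f :: "'a::euclidean_space \<Rightarrow> real"
  assumes f: "integrable lborel f"
    and box: "\<And>a b. (LINT x:box a b|lborel. f x) = 0"
  shows "AE x in lborel. f x = 0"
proof (rule density_unique_real[OF f])
  have ind: "set_integrable lborel A f" if "A \<in> sets borel" for A
    using that integrable_mult_indicator[of A lborel f] f by (simp add: set_integrable_def)
  \<comment> \<open>Closure under complements needs the integral over the whole space, obtained by
    exhausting it with boxes.\<close>
  have UN: "(LINT x:(UNIV::'a set)|lborel. f x) = 0"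
  proof -
    let ?B = "\<lambda>n. box (- (real n *\<^sub>R One)) (real n *\<^sub>R One) :: 'a set"
    have "(\<lambda>n. LINT x:?B n|lborel. f x) \<longlonglongrightarrow> (LINT x:(\<Union>n. ?B n)|lborel. f x)"
    proof (rule set_integral_cont_up)
      show "incseq ?B"
        by (force simp: incseq_def mem_box)
      show "set_integrable lborel (\<Union>n. ?B n) f" by (auto intro: ind)
    qed auto
    then show ?thesis by (simp add: box LIMSEQ_const_iff UN_box_eq_UNIV)
  qed
  fix A :: "'a set" assume "A \<in> sets lborel"
  then have A: "A \<in> sigma_sets UNIV (range (\<lambda>(a, b). box a b))"
    by (simp add: borel_eq_box)
  have "Int_stable (range (\<lambda>(a, b). box a b :: 'a set))"
    by (force simp: Int_stable_def box_Int_box)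
  moreover have "range (\<lambda>(a, b). box a b :: 'a set) \<subseteq> Pow UNIV" by simp
  ultimately have "(LINT x:A|lborel. f x) = 0"
    using A
  proof (induction rule: sigma_sets_induct_disjoint)
    case (basic A)
    then show ?case using box by auto
  next
    case (compl A)
    have A: "A \<in> sets borel" using compl by (simp add: borel_eq_box)
    have "(LINT x:(UNIV - A) \<union> A|lborel. f x) = (LINT x:UNIV - A|lborel. f x) + (LINT x:A|lborel. f x)"
      by (rule set_integral_Un) (use A in \<open>auto intro!: ind\<close>)
    then show ?case using UN compl by simp
  next
    case (union A)
    have A: "A i \<in> sets borel" for i using union(2) by (auto simp: borel_eq_box)
    have "(LINT x:(\<Union>i. A i)|lborel. f x) = (\<Sum>i. LINT x:A i|lborel. f x)"
      using union(1) A
      by (intro lebesgue_integral_countable_add) (auto intro!: ind simp: disjoint_family_on_def)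
    then show ?case using union by simp
  qed (auto simp: set_lebesgue_integral_def)
  then show "(LINT x:A|lborel. f x) = (LINT x:A|lborel. 0)" by simp
qed auto

text \<open>The fundamental lemma of the calculus of variations. Dominated convergence along box
  bumps gives the integrals over boxes. As \<open>f\<close> is only locally integrable, the
  conclusion is first drawn on each of countably many growing boxes.\<close>

lemma AE_eq_0_of_test_functions:
  fixes f :: "'a::euclidean_space \<Rightarrow> real"
  assumes f: "\<And>S. compact S \<Longrightarrow> set_integrable lebesgue S f"
    and test: "\<And>\<phi>. test_function \<phi> \<Longrightarrow> (LINT x|lebesgue. f x * \<phi> x) = 0"
  shows "AE x in lebesgue. f x = 0"
proof -
  have bx: "(LINT x:box a b|lebesgue. f x) = 0" for a b
  proof -
    have i: "integrable lebesgue (\<lambda>x. indicator (cbox a b) x *\<^sub>R f x)"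
      using f[of "cbox a b"] by (simp add: set_integrable_def)
    have m: "(\<lambda>x. indicator (cbox a b) x *\<^sub>R f x) \<in> borel_measurable lebesgue"
      using i by blast
    have bm: "box_bump k a b \<in> borel_measurable lebesgue" for k
    proof -
      have "Ck 0 (box_bump k a b)" using test_function_box_bump[of k a b] by (simp add: test_function_def)
      then have "box_bump k a b \<in> borel_measurable lborel"
        by (simp add: borel_measurable_continuous_onI)
      then show ?thesis by (rule measurable_completion)
    qed
    \<comment> \<open>Inserting the indicator settles measurability: the hypothesis speaks only
      about \<open>f\<close> cut off to compact sets.\<close>
    have eq: "f x * box_bump k a b x = indicator (cbox a b) x *\<^sub>R f x * box_bump k a b x" for k x
      using box_bump_eq_0[of x a b k] box_subset_cbox[of a b] by (auto simp: indicator_def)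
    have "(\<lambda>k. LINT x|lebesgue. f x * box_bump k a b x) \<longlonglongrightarrow>
        (LINT x|lebesgue. indicator (box a b) x *\<^sub>R f x)"
    proof (rule integral_dominated_convergence[where w = "\<lambda>x. norm (indicator (cbox a b) x *\<^sub>R f x)"])
      have "indicator (box a b) x *\<^sub>R f x
          = indicator (box a b) x *\<^sub>R (indicator (cbox a b) x *\<^sub>R f x)" for x
        using box_subset_cbox[of a b] by (auto simp: indicator_def)
      then show "(\<lambda>x. indicator (box a b) x *\<^sub>R f x) \<in> borel_measurable lebesgue"
        by (subst measurable_cong, assumption) (intro borel_measurable_scaleR borel_measurable_indicator m, auto)
      show "(\<lambda>x. f x * box_bump k a b x) \<in> borel_measurable lebesgue" for k
        unfolding eq by (intro borel_measurable_times m bm)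
      show "integrable lebesgue (\<lambda>x. norm (indicator (cbox a b) x *\<^sub>R f x))"
        using i by (rule integrable_norm)
      show "AE x in lebesgue. (\<lambda>k. f x * box_bump k a b x) \<longlonglongrightarrow> indicator (box a b) x *\<^sub>R f x"
        by (auto intro!: AE_I2 simp: mult.commute[of "f _"] intro!: tendsto_mult_right box_bump_tendsto)
      show "AE x in lebesgue. norm (f x * box_bump k a b x) \<le> norm (indicator (cbox a b) x *\<^sub>R f x)" for k
        unfolding eq using box_bump_bounds[of k a b]
        by (intro AE_I2) (simp add: abs_mult mult_left_le)
    qed
    then show ?thesis
      by (simp add: test test_function_box_bump LIMSEQ_const_iff set_lebesgue_integral_def)
  qed
  have "AE x in lebesgue. x \<in> box (- (real n *\<^sub>R One)) (real n *\<^sub>R One) \<longrightarrow> f x = 0" for n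
  proof -
    let ?C = "box (- (real n *\<^sub>R One)) (real n *\<^sub>R One) :: 'a set"
    let ?h = "\<lambda>x. indicator ?C x *\<^sub>R f x"
    have "set_integrable lebesgue ?C f"
      by (rule set_integrable_subset[OF f[OF compact_cbox] _ box_subset_cbox]) simp
    then have i: "integrable lebesgue ?h" by (simp add: set_integrable_def)
    \<comment> \<open>The box criterion lives on \<open>lborel\<close>, so the cut-off function is
      replaced by a Borel representative. The integrals of \<open>g\<close> over boxes are those of
      \<open>f\<close> over the intersection with \<open>?C\<close>, again a box.\<close>
    obtain g where g: "g \<in> borel_measurable lborel" "AE x in lborel. ?h x = g x"
      using completion_ex_borel_measurable_real[OF borel_measurable_integrable[OF i]] by auto
    have ae: "AE x in lebesgue. ?h x = g x" using g(2) by (rule AE_completion)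
    have gl: "g \<in> borel_measurable lebesgue" using g(1) by (rule measurable_completion)
    have "integrable lebesgue g"
      using i integrable_cong_AE[OF borel_measurable_integrable[OF i] gl ae] by simp
    then have gi: "integrable lborel g"
      using integrable_completion[OF g(1)] by simp
    have "AE x in lborel. g x = 0"
    proof (rule AE_eq_0_of_box_integrals[OF gi])
      fix a b :: 'a
      have bm: "box a b \<in> sets lborel" by simp
      have "(LINT x:box a b|lborel. g x) = (LINT x:box a b|lebesgue. g x)"
        unfolding set_lebesgue_integral_def
        by (rule integral_completion[symmetric]) (use g(1) in measurable)
      also have "\<dots> = (LINT x:box a b|lebesgue. ?h x)"
        unfolding set_lebesgue_integral_def
      proof (rule integral_cong_AE)
        show "(\<lambda>x. indicator (box a b) x *\<^sub>R g x) \<in> borel_measurable lebesgue"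
          by (intro borel_measurable_scaleR borel_measurable_indicator gl) auto
        show "(\<lambda>x. indicator (box a b) x *\<^sub>R ?h x) \<in> borel_measurable lebesgue"
          by (intro borel_measurable_scaleR[OF borel_measurable_indicator borel_measurable_integrable[OF i]]) auto
        show "AE x in lebesgue. indicator (box a b) x *\<^sub>R g x = indicator (box a b) x *\<^sub>R ?h x"
          using ae by eventually_elim simp
      qed
      also have "\<dots> = (LINT x:box a b \<inter> ?C|lebesgue. f x)"
        unfolding set_lebesgue_integral_def
        by (rule Bochner_Integration.integral_cong) (auto simp: indicator_def)
      also have "\<dots> = 0"
        unfolding box_Int_box by (rule bx)
      finally show "(LINT x:box a b|lborel. g x) = 0" .
    qed
    then have "AE x in lebesgue. g x = 0" by (rule AE_completion)
    with ae show ?thesis by eventually_elim (auto simp: indicator_def split: if_splits)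
  qed
  then have "AE x in lebesgue. \<forall>n. x \<in> box (- (real n *\<^sub>R One)) (real n *\<^sub>R One) \<longrightarrow> f x = 0"
    by (subst AE_all_countable) blast
  then show ?thesis
  proof eventually_elim
    case (elim x)
    have "x \<in> (\<Union>n. box (- (real n *\<^sub>R One)) (real n *\<^sub>R One))"
      by (simp add: UN_box_eq_UNIV)
    then show ?case using elim by blast
  qed
qed

text \<open>The derivative of the compactly supported product integrates to zero, and the product
  rule splits it. Integrability is recorded as well, since later the integral of a difference has to
  be separated.\<close>

lemma integral_by_parts_test:
  fixes f :: "'a::euclidean_space \<Rightarrow> real"
  assumes f: "Ck 1 f" and \<phi>: "test_function \<phi>" and b: "b \<in> Basis"
  shows "(LINT x|lebesgue. f x * pd b \<phi> x) = - (LINT x|lebesgue. pd b f x * \<phi> x)"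
    and "integrable lebesgue (\<lambda>x. pd b f x * \<phi> x)"
proof -
  have C\<phi>: "Ck k \<phi>" for k using \<phi> by (simp add: test_function_def)
  obtain R where R: "\<And>x. norm x > R \<Longrightarrow> \<phi> x = 0"
    using test_function_bounded_support[OF \<phi>] by blast
  have pd0: "pd b \<phi> x = 0" if "norm x > R" for x
  proof (rule pd_eq[where D = "\<lambda>_. 0"])
    have "open {x::'a. R < norm x}" by (intro open_Collect_less continuous_intros)
    then show "(\<phi> has_derivative (\<lambda>_. 0)) (at x)"
      using that R
      by (intro has_derivative_transform_within_open[OF has_derivative_const[of 0]]) auto
  qed
  have df: "f differentiable (at x)" "\<phi> differentiable (at x)" for x
    using f C\<phi>[of 1] by auto
  have c: "continuous_on UNIV f" "continuous_on UNIV \<phi>" "continuous_on UNIV (pd b f)" "continuous_on UNIV (pd b \<phi>)"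
    using f b C\<phi>[of 1] Ck_continuous_on[OF f] Ck_continuous_on[OF C\<phi>] by auto
  have i1: "integrable lborel (\<lambda>x. f x * pd b \<phi> x)"
    by (rule integrable_continuous_bounded_support[of _ R]) (auto intro!: continuous_intros c simp: pd0)
  have i2: "integrable lborel (\<lambda>x. pd b f x * \<phi> x)"
    by (rule integrable_continuous_bounded_support[of _ R]) (auto intro!: continuous_intros c simp: R)
  have "(LINT x|lborel. pd b (\<lambda>x. f x * \<phi> x) x) = 0"
  proof (rule integral_pd_eq_0)
    show "Ck 1 (\<lambda>x. f x * \<phi> x)" by (intro Ck_mult f C\<phi>)
    show "f x * \<phi> x = 0" if "norm x > R" for x using R[OF that] by simp
  qed (use b in auto)
  then have "(LINT x|lborel. f x * pd b \<phi> x) = - (LINT x|lborel. pd b f x * \<phi> x)"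
    using i1 i2 by (simp add: pd_mult[OF df])
  moreover have "(\<lambda>x. f x * pd b \<phi> x) \<in> borel_measurable lborel" "(\<lambda>x. pd b f x * \<phi> x) \<in> borel_measurable lborel"
    using i1 i2 by blast+
  ultimately show "(LINT x|lebesgue. f x * pd b \<phi> x) = - (LINT x|lebesgue. pd b f x * \<phi> x)"
    by (simp add: integral_completion)
  show "integrable lebesgue (\<lambda>x. pd b f x * \<phi> x)"
    using i2 by (simp add: integrable_completion borel_measurable_integrable)
qed

lemma set_integrable_continuous_compact:
  fixes f :: "'a::euclidean_space \<Rightarrow> real"
  assumes "continuous_on UNIV f" "compact S"
  shows "set_integrable lebesgue S f"
proof -
  have i: "integrable lborel (\<lambda>x. indicator S x *\<^sub>R f x)"
    by (rule borel_integrable_compact) (use assms in \<open>auto intro: continuous_on_subset\<close>)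
  then show ?thesis
    by (simp add: set_integrable_def integrable_completion borel_measurable_integrable)
qed

lemma integrable_mult_test_function:
  fixes f :: "'a::euclidean_space \<Rightarrow> real"
  assumes f: "\<And>S. compact S \<Longrightarrow> set_integrable lebesgue S f" and \<phi>: "test_function \<phi>"
  shows "integrable lebesgue (\<lambda>x. f x * \<phi> x)"
proof -
  have C\<phi>: "Ck 0 \<phi>" using \<phi> by (simp add: test_function_def)
  obtain R where R: "\<And>x. norm x > R \<Longrightarrow> \<phi> x = 0"
    using test_function_bounded_support[OF \<phi>] by blast
  have "continuous_on UNIV \<phi>" by (rule Ck_continuous_on[OF C\<phi>])
  then have m: "\<phi> \<in> borel_measurable lebesgue"
    by (intro measurable_completion) (simp add: borel_measurable_continuous_onI)
  obtain M where M: "\<And>x. norm x \<le> R \<Longrightarrow> \<bar>\<phi> x\<bar> \<le> M"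
    using compact_imp_bounded[OF compact_continuous_image[OF Ck_continuous_on[OF C\<phi>], of "cball 0 R"]]
    by (force simp: bounded_iff)
  let ?h = "\<lambda>x. indicator (cball 0 R) x *\<^sub>R f x"
  have i: "integrable lebesgue ?h" using f[of "cball 0 R"] by (simp add: set_integrable_def)
  have eq: "f x * \<phi> x = ?h x * \<phi> x" for x using R[of x] by (auto simp: indicator_def)
  have "integrable lebesgue (\<lambda>x. M * ?h x)" using i by simp
  then show ?thesis
  proof (rule Bochner_Integration.integrable_bound)
    show "(\<lambda>x. f x * \<phi> x) \<in> borel_measurable lebesgue"
      unfolding eq by (intro borel_measurable_times m borel_measurable_integrable[OF i])
    show "AE x in lebesgue. norm (f x * \<phi> x) \<le> norm (M * ?h x)"
    proof (intro AE_I2)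
      fix x
      have "\<bar>\<phi> x\<bar> * \<bar>f x\<bar> \<le> \<bar>M\<bar> * \<bar>f x\<bar>" if "norm x \<le> R"
        using M[OF that] by (intro mult_right_mono) auto
      then show "norm (f x * \<phi> x) \<le> norm (M * ?h x)"
        using R[of x] by (cases "norm x \<le> R") (auto simp: abs_mult mult.commute)
    qed
  qed
qed

text \<open>Integration by parts shows that the classical partial derivatives satisfy the identity
  defining \<open>G\<close>; the difference is therefore orthogonal to every test function.\<close>

lemma weak_derivative_AE_eq:
  fixes f :: "real ^ 'n \<Rightarrow> real ^ 'm"
  assumes f: "\<And>i. Ck 1 (\<lambda>x. f x $ i)" and G: "locally_Lp p G" "p \<ge> 1" and w: "weak_derivative f G"
  shows "AE x in lebesgue. \<forall>i j. G x $ i $ j = pd (axis j 1) (\<lambda>x. f x $ i) x"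
proof -
  have "AE x in lebesgue. G x $ i $ j - pd (axis j 1) (\<lambda>x. f x $ i) x = 0" for i j
  proof (rule AE_eq_0_of_test_functions)
    let ?b = "axis j 1 :: real ^ 'n"
    have b: "?b \<in> Basis" by simp
    have cpd: "continuous_on UNIV (pd ?b (\<lambda>x. f x $ i))"
      using f[of i] b by (simp del: axis_in_Basis_iff)
    have s1: "set_integrable lebesgue S (\<lambda>x. G x $ i $ j)" if "compact S" for S
    proof -
      have "set_integrable lebesgue S G" by (rule locally_Lp_integrable[OF G that])
      then have I: "integrable lebesgue (\<lambda>x. indicator S x *\<^sub>R G x)" by (simp add: set_integrable_def)
      have "bounded_linear (\<lambda>M::real^'n^'m. M $ i $ j)"
        by (intro bounded_linear_compose[OF bounded_linear_vec_nth bounded_linear_vec_nth])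
      from integrable_bounded_linear[OF this I] show ?thesis
        by (simp add: set_integrable_def)
    qed
    have s2: "set_integrable lebesgue S (pd ?b (\<lambda>x. f x $ i))" if "compact S" for S
      by (rule set_integrable_continuous_compact[OF cpd that])
    show "set_integrable lebesgue S (\<lambda>x. G x $ i $ j - pd ?b (\<lambda>x. f x $ i) x)" if "compact S" for S
      by (intro set_integral_diff s1 s2 that)
    fix \<phi> :: "real ^ 'n \<Rightarrow> real" assume \<phi>: "test_function \<phi>"
    have "(LINT x|lebesgue. f x $ i * pd ?b \<phi> x) = - (LINT x|lebesgue. G x $ i $ j * \<phi> x)"
      using w \<phi> by (simp add: weak_derivative_def)
    moreover have "(LINT x|lebesgue. f x $ i * pd ?b \<phi> x)
        = - (LINT x|lebesgue. pd ?b (\<lambda>x. f x $ i) x * \<phi> x)"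
      by (rule integral_by_parts_test(1)[OF f \<phi> b])
    ultimately show "(LINT x|lebesgue. (G x $ i $ j - pd ?b (\<lambda>x. f x $ i) x) * \<phi> x) = 0"
      using integrable_mult_test_function[OF s1 \<phi>] integral_by_parts_test(2)[OF f \<phi> b]
      by (simp add: left_diff_distrib)
  qed
  then show ?thesis by (simp add: AE_all_countable)
qed

text \<open>The set where the inequality fails is open by continuity and also null, and nonempty
  open sets are not null.\<close>

lemma AE_continuous_le:
  fixes f g :: "'a::euclidean_space \<Rightarrow> real"
  assumes "AE x in lebesgue. f x \<le> g x" "continuous_on UNIV f" "continuous_on UNIV g"
  shows "f x \<le> g x"
proof -
  have o: "open {x. g x < f x}" using assms by (intro open_Collect_less)
  obtain N where N: "N \<in> null_sets lebesgue" "{x. \<not> f x \<le> g x} \<subseteq> N"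
    using assms(1) by (auto simp: eventually_ae_filter)
  have "negligible {x. g x < f x}"
    by (rule negligible_subset[of N]) (use N in \<open>auto simp: negligible_iff_null_sets\<close>)
  then have "{x. g x < f x} = {}"
    using open_not_negligible o by blast
  then show ?thesis by (auto simp: not_less)
qed

section \<open>The classical differential of a quasiregular map\<close>

lemma has_derivative_vec_pd:
  fixes f :: "real ^ 'n \<Rightarrow> real ^ 'm"
  assumes "\<And>i. Ck 1 (\<lambda>x. f x $ i)"
  shows "(f has_derivative (\<lambda>h. \<chi> i. pd h (\<lambda>x. f x $ i) x)) (at x)"
proof -
  have "((\<lambda>x. f x $ i) has_derivative (\<lambda>h. pd h (\<lambda>x. f x $ i) x)) (at x)" for i
    using assms[of i] by (intro pd_has_derivative) simp
  then show ?thesis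
    by (subst has_derivative_componentwise_within) (auto simp: Basis_vec_def inner_axis)
qed

lemma frechet_derivative_vec_pd:
  fixes f :: "real ^ 'n \<Rightarrow> real ^ 'm"
  assumes "\<And>i. Ck 1 (\<lambda>x. f x $ i)"
  shows "frechet_derivative f (at x) = (\<lambda>h. \<chi> i. pd h (\<lambda>x. f x $ i) x)"
  by (rule frechet_derivative_at[symmetric]) (rule has_derivative_vec_pd[OF assms])

lemma jacobian_vec_pd:
  fixes f :: "real ^ 'n \<Rightarrow> real ^ 'm"
  assumes "\<And>i. Ck 1 (\<lambda>x. f x $ i)"
  shows "jacobian f (at x) = (\<chi> i j. pd (axis j 1) (\<lambda>x. f x $ i) x)"
  by (simp add: jacobian_def frechet_derivative_vec_pd[OF assms] matrix_def)

text \<open>Once the distortion inequality holds everywhere, a zero of the determinant makes its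
  right-hand side zero whatever \<open>K\<close> is, and so every entry of the differential
  vanishes.\<close>

lemma sense_preserving_quasiregular_critical:
  fixes f :: "real ^ 'n \<Rightarrow> real ^ 'n"
  assumes f: "\<And>i. Ck 1 (\<lambda>x. f x $ i)" and qr: "sense_preserving_quasiregular f" and jac: "jac f x = 0"
  shows "frechet_derivative f (at x) = (\<lambda>h. 0)"
proof -
  define M where "M x = (\<chi> i j. pd (axis j 1) (\<lambda>x. f x $ i) x)" for x
  have fd: "frechet_derivative f (at x) = (\<lambda>h. \<chi> i. pd h (\<lambda>x. f x $ i) x)" for x
    by (rule frechet_derivative_vec_pd[OF f])
  have jM: "jac f x = det (M x)" for x
    by (simp add: jac_def jacobian_vec_pd[OF f] M_def)
  obtain G K where G: "locally_Lp CARD('n) G" "weak_derivative f G"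
    and K: "AE x in lebesgue. onorm ((*v) (G x)) ^ CARD('n) \<le> K * det (G x)"
    using qr unfolding sense_preserving_quasiregular_def by blast
  have "1 \<le> CARD('n)" by simp
  from weak_derivative_AE_eq[OF f G(1) this G(2)] have ae: "AE x in lebesgue. G x = M x"
    by eventually_elim (simp add: M_def vec_eq_iff)
  have cM: "continuous_on UNIV (\<lambda>x. M x $ i $ j)" for i j
  proof -
    have "axis j 1 \<in> (Basis :: (real ^ 'n) set)" by simp
    then show ?thesis using f[of i] by (simp add: M_def del: axis_in_Basis_iff)
  qed
  \<comment> \<open>Entries replace the operator norm: they are bounded by it, and their continuity
    is immediate.\<close>
  have "\<bar>M x $ i $ j\<bar> ^ CARD('n) \<le> K * det (M x)" for i j x
  proof (rule AE_continuous_le[of "\<lambda>x. \<bar>M x $ i $ j\<bar> ^ CARD('n)" "\<lambda>x. K * det (M x)"])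
    show "AE x in lebesgue. \<bar>M x $ i $ j\<bar> ^ CARD('n) \<le> K * det (M x)"
      using ae K
    proof eventually_elim
      case (elim x)
      have "\<bar>M x $ i $ j\<bar> ^ CARD('n) \<le> onorm ((*v) (M x)) ^ CARD('n)"
        by (intro power_mono matrix_component_le_onorm) auto
      then show ?case using elim by simp
    qed
    show "continuous_on UNIV (\<lambda>x. \<bar>M x $ i $ j\<bar> ^ CARD('n))"
      by (intro continuous_intros cM)
    show "continuous_on UNIV (\<lambda>x. K * det (M x))"
      unfolding det_def by (intro continuous_intros cM)
  qed
  from this[of x] have "\<bar>M x $ i $ j\<bar> ^ CARD('n) = 0" for i j
    using jac by (intro antisym) (simp_all add: jM)
  then have M0: "M x = 0" by (simp add: vec_eq_iff)
  have lin: "linear (frechet_derivative f (at x))"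
    unfolding fd by (rule has_derivative_linear[OF has_derivative_vec_pd[OF f]])
  have "matrix (frechet_derivative f (at x)) = M x"
    by (simp add: fd M_def matrix_def)
  then have "frechet_derivative f (at x) h = M x *v h" for h
    using matrix_works[of "frechet_derivative f (at x)" h] lin
    by (simp add: linear_matrix_vector_mul_eq)
  then show ?thesis by (simp add: M0 fun_eq_iff)
qed

section \<open>Orthogonal symmetry and the Jacobian\<close>

lemma permutes_fixing_all_but_two:
  assumes p: "p permutes UNIV" and fx: "\<And>i. i \<noteq> a \<Longrightarrow> i \<noteq> b \<Longrightarrow> p i = i" and "a \<noteq> b"
  shows "p = id \<or> p = Transposition.transpose a b"
proof -
  have inj: "inj p" using p by (rule permutes_inj)
  have "p a \<in> {a, b}" "p b \<in> {a, b}"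
    using fx inj by (metis injD insertCI)+
  moreover have "p a \<noteq> p b" using inj \<open>a \<noteq> b\<close> by (meson injD)
  ultimately consider "p a = a" "p b = b" | "p a = b" "p b = a" by auto
  then show ?thesis
  proof cases
    case 1
    then have "p = id" using fx by (metis eq_id_iff)
    then show ?thesis ..
  next
    case 2
    then have "p = Transposition.transpose a b" using fx by (metis ext transpose_apply_first transpose_apply_second transpose_apply_other)
    then show ?thesis ..
  qed
qed

text \<open>In the Leibniz formula a permutation that moves an index outside {a, b} picks a zero
  entry there. Only the identity and the transposition of a and b remain.\<close>

lemma det_diagonal_except_block:
  fixes A :: "real ^ 'n ^ 'n"
  assumes "a \<noteq> b"
    and off: "\<And>i j. i \<noteq> j \<Longrightarrow> \<not> {i, j} \<subseteq> {a, b} \<Longrightarrow> A $ i $ j = 0"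
    and diag: "\<And>i. i \<notin> {a, b} \<Longrightarrow> A $ i $ i = \<alpha>"
  shows "det A = \<alpha> ^ (CARD('n) - 2) * (A $ a $ a * A $ b $ b - A $ a $ b * A $ b $ a)"
proof -
  let ?t = "\<lambda>p. of_int (sign p) * (\<Prod>i\<in>UNIV. A $ i $ p i)"
  have ne: "id \<noteq> Transposition.transpose a b" using assms(1) by (metis id_apply transpose_apply_first)
  have rest: "(\<Prod>i\<in>UNIV - {a, b}. A $ i $ i) = \<alpha> ^ (CARD('n) - 2)"
    using assms(1) by (simp add: diag card_Diff_subset numeral_2_eq_2)
  have split: "(\<Prod>i\<in>UNIV. A $ i $ p i)
      = A $ a $ p a * A $ b $ p b * (\<Prod>i\<in>UNIV - {a, b}. A $ i $ p i)" for p
    using prod.subset_diff[of "{a, b}" UNIV "\<lambda>i. A $ i $ p i"] assms(1) by (simp add: mult_ac)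
  have "det A = (\<Sum>p\<in>{id, Transposition.transpose a b}. ?t p)"
    unfolding det_def
  proof (rule sum.mono_neutral_right)
    show "\<forall>p\<in>{p. p permutes UNIV} - {id, Transposition.transpose a b}. ?t p = 0"
    proof
      fix p assume p: "p \<in> {p. p permutes UNIV} - {id, Transposition.transpose a b}"
      then obtain i where "i \<noteq> a" "i \<noteq> b" "p i \<noteq> i"
        using permutes_fixing_all_but_two[of p a b] assms(1) by blast
      then have "A $ i $ p i = 0" by (intro off) auto
      then show "?t p = 0" by (auto intro: prod_zero)
    qed
  qed (auto simp: finite_permutations permutes_id permutes_swap_id)
  also have "\<dots> = ?t id + ?t (Transposition.transpose a b)" using ne by simp
  also have "?t id = A $ a $ a * A $ b $ b * \<alpha> ^ (CARD('n) - 2)"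
    by (simp only: split) (simp add: rest)
  also have "(\<Prod>i\<in>UNIV - {a, b}. A $ i $ Transposition.transpose a b i) = \<alpha> ^ (CARD('n) - 2)"
    by (subst rest[symmetric]) (rule prod.cong, auto simp: transpose_def)
  then have "?t (Transposition.transpose a b) = - (A $ a $ b * A $ b $ a * \<alpha> ^ (CARD('n) - 2))"
    by (simp only: split) (simp add: sign_swap_id assms(1))
  finally show ?thesis by (simp add: algebra_simps)
qed

section \<open>The splitting into (y, t) and the action of the orthogonal group\<close>

lemma norm_join: "(norm (join y t))\<^sup>2 = (norm y)\<^sup>2 + t\<^sup>2"
  by (simp add: norm_vec_def L2_set_def sum_nonneg UNIV_option_conv sum.reindex join_def)

lemma join_eq_0_iff [simp]: "join y t = 0 \<longleftrightarrow> y = 0 \<and> t = 0"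
  by (auto simp: join_def vec_eq_iff split: option.splits)

lemma join_eq_iff [simp]: "join y t = join y' t' \<longleftrightarrow> y = y' \<and> t = t'"
  by (metis ycoord_join tcoord_join)

lemma linear_act: "linear (act R)"
  by (auto simp: act_def join_def ycoord_def tcoord_def vec_eq_iff matrix_vector_mult_def
      sum.distrib sum_distrib_left algebra_simps intro!: linearI split: option.splits)

lemma act_join [simp]: "act R (join y t) = join (R *v y) t"
  by (simp add: act_def)

lemma act_act: "act R (act S x) = act (R ** S) x"
  by (simp add: act_def matrix_vector_mul_assoc)

lemma act_transpose_act [simp]: "orthogonal_matrix R \<Longrightarrow> act (transpose R) (act R x) = x"
  by (simp add: act_act orthogonal_matrix_def) (simp add: act_def)

lemma norm_orthogonal_matrix:
  fixes R :: "real ^ 'n ^ 'n"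
  shows "orthogonal_matrix R \<Longrightarrow> norm (R *v y) = norm y"
  using orthogonal_transformation_norm[of "(*v) R" y] by (simp add: orthogonal_transformation_matrix)

lemma obtain_rotation:
  fixes y z :: "real ^ 'n"
  assumes "norm y = norm z"
  obtains R :: "real ^ 'n ^ 'n" where "orthogonal_matrix R" "R *v y = z"
proof -
  obtain f where "orthogonal_transformation f" "f y = z"
    using orthogonal_transformation_exists[OF assms] by blast
  then show ?thesis
    using that[of "matrix f"] orthogonal_transformation_matrix[of f]
    by (simp add: matrix_works)
qed

text \<open>Differentiating the equivariance relation intertwines the differentials at x and at its
  image with the linear map \<open>act R\<close>, whose nonzero determinant cancels.\<close>

lemma jac_equivariant:
  fixes P :: "real ^ ('d::finite option) \<Rightarrow> real ^ ('d option)"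
  assumes eq: "equivariant P" and diff: "\<And>x. P differentiable (at x)" and R: "orthogonal_matrix R"
  shows "jac P (act R x) = jac P x"
proof -
  let ?D = "\<lambda>x. frechet_derivative P (at x)"
  have D: "(P has_derivative ?D x) (at x)" for x
    using diff frechet_derivative_works by blast
  have lD: "linear (?D x)" for x using D by (rule has_derivative_linear)
  have dA: "(act R has_derivative act R) (at x)" for x
    by (rule linear_imp_has_derivative[OF linear_act])
  have 1: "((\<lambda>x. P (act R x)) has_derivative (\<lambda>h. ?D (act R x) (act R h))) (at x)"
    by (rule has_derivative_compose[OF dA D])
  have 2: "((\<lambda>x. act R (P x)) has_derivative (\<lambda>h. act R (?D x h))) (at x)"
    by (rule has_derivative_compose[OF D dA])
  have "(\<lambda>x. P (act R x)) = (\<lambda>x. act R (P x))"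
    using eq R by (simp add: equivariant_def)
  then have "?D (act R x) \<circ> act R = act R \<circ> ?D x"
    using has_derivative_unique[OF 1] 2 by (simp add: comp_def)
  then have "matrix (?D (act R x)) ** matrix (act R) = matrix (act R) ** matrix (?D x)"
    using lD linear_act by (metis matrix_compose linear_matrix_vector_mul_eq)
  then have "det (matrix (?D (act R x))) * det (matrix (act R)) = det (matrix (act R)) * det (matrix (?D x))"
    by (metis det_mul)
  moreover have "det (matrix (act R)) \<noteq> 0"
  proof -
    have "act (transpose R) \<circ> act R = id"
      using R by (auto simp: fun_eq_iff)
    then have "matrix (act (transpose R)) ** matrix (act R) = mat 1"
      using linear_act by (metis matrix_compose linear_matrix_vector_mul_eq matrix_id_mat_1)
    then show ?thesis by (metis det_I det_mul mult_zero_right zero_neq_one)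
  qed
  ultimately show ?thesis by (simp add: jac_def jacobian_def)
qed

section \<open>The four-parameter family: symmetry, derivatives, Laplacian, Jacobian\<close>

lemma equivariant_equiv_cubic: "equivariant (equiv_cubic a b c e)"
  unfolding equivariant_def equiv_cubic_def Let_def act_def
  by (simp add: norm_orthogonal_matrix matrix_vector_mult_scaleR)

text \<open>The second and fourth coefficients are the solutions of a + (d + 2) b = 0 and 3 c + d e
  = 0.\<close>

lemma harm_cubic_eq_equiv_cubic:
  "(harm_cubic a c :: real ^ ('d::finite option) \<Rightarrow> real ^ ('d option)) =
     equiv_cubic a (- a / (real CARD('d) + 2)) c (- 3 * c / real CARD('d))"
proof
  fix x :: "real ^ ('d option)"
  have "a * (t\<^sup>2 - N / (real CARD('d) + 2)) = a * t\<^sup>2 + - a / (real CARD('d) + 2) * N"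
    "c * (t ^ 3 - 3 / real CARD('d) * t * N) = c * t ^ 3 + - 3 * c / real CARD('d) * t * N" for t N
    by (simp_all add: algebra_simps)
  then show "harm_cubic a c x = equiv_cubic a (- a / (real CARD('d) + 2)) c (- 3 * c / real CARD('d)) x"
    by (simp only: harm_cubic_def equiv_cubic_def Let_def)
qed

lemma equiv_cubic_Some:
  "equiv_cubic a b c e x $ Some i =
     (a * (x $ None)\<^sup>2 + b * (\<Sum>k\<in>UNIV. (x $ Some k)\<^sup>2)) * x $ Some i"
  by (simp add: equiv_cubic_def join_def Let_def tcoord_def ycoord_def norm_vec_def L2_set_def sum_nonneg)

lemma equiv_cubic_None:
  "equiv_cubic a b c e x $ None = c * x $ None ^ 3 + e * x $ None * (\<Sum>k\<in>UNIV. (x $ Some k)\<^sup>2)"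
  by (simp add: equiv_cubic_def join_def Let_def tcoord_def ycoord_def norm_vec_def L2_set_def sum_nonneg)

lemma Ck_equiv_cubic: "Ck k (\<lambda>x. equiv_cubic a b c e x $ i)"
  by (cases i; simp only: equiv_cubic_Some equiv_cubic_None)
    (intro Ck_mult Ck_add Ck_sum Ck_power Ck_const Ck_component)+

lemma equiv_cubic_scale: "equiv_cubic a b c e (s *\<^sub>R x) = s ^ 3 *\<^sub>R equiv_cubic a b c e x"
proof -
  have "equiv_cubic a b c e (s *\<^sub>R x) $ i = (s ^ 3 *\<^sub>R equiv_cubic a b c e x) $ i" for i
    by (cases i)
      (simp_all add: equiv_cubic_Some equiv_cubic_None power_mult_distrib sum_distrib_left[symmetric]
        power2_eq_square power3_eq_cube algebra_simps)
  then show ?thesis by (simp add: vec_eq_iff)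
qed

lemma component_has_derivative: "((\<lambda>x. x $ i) has_derivative (\<lambda>h. h $ i)) (at x)"
  by (rule bounded_linear_imp_has_derivative[OF bounded_linear_vec_nth])

lemma equiv_cubic_Some_has_derivative:
  "((\<lambda>x. equiv_cubic a b c e x $ Some i) has_derivative
    (\<lambda>h. (2 * a * x $ None * h $ None + 2 * b * (\<Sum>k\<in>UNIV. x $ Some k * h $ Some k)) * x $ Some i
       + (a * (x $ None)\<^sup>2 + b * (\<Sum>k\<in>UNIV. (x $ Some k)\<^sup>2)) * h $ Some i)) (at x)"
  unfolding equiv_cubic_Some
  by (auto intro!: derivative_eq_intros component_has_derivative
      simp: fun_eq_iff sum_distrib_left sum.distrib algebra_simps)

lemma equiv_cubic_None_has_derivative:
  "((\<lambda>x. equiv_cubic a b c e x $ None) has_derivative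
    (\<lambda>h. (3 * c * (x $ None)\<^sup>2 + e * (\<Sum>k\<in>UNIV. (x $ Some k)\<^sup>2)) * h $ None
       + 2 * e * x $ None * (\<Sum>k\<in>UNIV. x $ Some k * h $ Some k))) (at x)"
  unfolding equiv_cubic_None
  by (auto intro!: derivative_eq_intros component_has_derivative
      simp: fun_eq_iff sum_distrib_left sum.distrib algebra_simps)

lemma sum_Basis_axis: "(\<Sum>b\<in>(Basis :: (real ^ 'n) set). f b) = (\<Sum>i\<in>UNIV. f (axis i 1))"
proof -
  have "(Basis :: (real ^ 'n) set) = range (\<lambda>i. axis i 1)"
    by (auto simp: Basis_vec_def)
  moreover have "inj (\<lambda>i::'n. axis i (1::real))"
    by (simp add: inj_on_def axis_eq_axis)
  ultimately show ?thesis
    by (subst \<open>Basis = _\<close>) (subst sum.reindex, auto)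
qed

text \<open>Writing q = a t^2 + b |y|^2, the Laplacian of q times a y-coordinate is that coordinate
  times 2 a + 2 d b, plus twice the product of the gradients, which adds 4 b times the coordinate.
  Hence the shift from d to d + 2.\<close>

lemma laplacian_equiv_cubic_Some:
  fixes x :: "real ^ ('d::finite option)"
  shows "laplacian (\<lambda>x. equiv_cubic a b c e x $ Some i) x = 2 * (a + (real CARD('d) + 2) * b) * x $ Some i"
proof -
  let ?g = "\<lambda>h x. (2 * a * x $ None * h $ None + 2 * b * (\<Sum>k\<in>UNIV. x $ Some k * h $ Some k)) * x $ Some i
       + (a * (x $ None)\<^sup>2 + b * (\<Sum>k\<in>UNIV. (x $ Some k)\<^sup>2)) * h $ Some i"
  have 1: "pd h (\<lambda>x. equiv_cubic a b c e x $ Some i) = ?g h" for h :: "real ^ ('d option)"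
    by (rule ext, rule pd_eq, rule equiv_cubic_Some_has_derivative)
  have D: "((?g h) has_derivative (\<lambda>k. (2 * a * k $ None * h $ None + 2 * b * (\<Sum>j\<in>UNIV. k $ Some j * h $ Some j)) * x $ Some i
      + (2 * a * x $ None * h $ None + 2 * b * (\<Sum>j\<in>UNIV. x $ Some j * h $ Some j)) * k $ Some i
      + (2 * a * x $ None * k $ None + 2 * b * (\<Sum>j\<in>UNIV. x $ Some j * k $ Some j)) * h $ Some i)) (at x)"
    for h :: "real ^ ('d option)"
    by (auto intro!: derivative_eq_intros component_has_derivative
      simp: fun_eq_iff sum_distrib_left sum.distrib algebra_simps)
  \<comment> \<open>On a coordinate axis the product of \<open>h $ None\<close> and
    \<open>h $ Some i\<close> is zero, so the third term drops out; the last one survives only for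
    the axis \<open>Some i\<close>.\<close>
  have G: "pd h (?g h) x = 2 * a * (h $ None)\<^sup>2 * x $ Some i + 2 * b * (\<Sum>j\<in>UNIV. (h $ Some j)\<^sup>2) * x $ Some i
      + 4 * a * x $ None * (h $ None * h $ Some i) + 4 * b * (\<Sum>j\<in>UNIV. x $ Some j * h $ Some j) * h $ Some i"
    for h :: "real ^ ('d option)"
    unfolding pd_eq[OF D] by (simp add: power2_eq_square algebra_simps)
  have S1: "(\<Sum>j\<in>UNIV. x $ Some j * axis l 1 $ Some j) = (case l of None \<Rightarrow> 0 | Some l \<Rightarrow> x $ Some l)" for l :: "'d option"
    by (auto simp: axis_def if_distrib cong: if_cong split: option.splits)
  have S2: "(\<Sum>j\<in>UNIV. ((axis l 1 :: real ^ ('d option)) $ Some j)\<^sup>2) = (case l of None \<Rightarrow> 0 | Some l \<Rightarrow> 1)" for l :: "'d option"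
    by (auto simp: axis_def if_distrib[of "\<lambda>x. x\<^sup>2"] cong: if_cong split: option.splits)
  show ?thesis
    unfolding laplacian_def sum_Basis_axis 1 G S1 S2 UNIV_option_conv
    by (simp add: sum.reindex sum.distrib axis_def mult_delta_right) (simp add: algebra_simps)
qed

lemma laplacian_equiv_cubic_None:
  fixes x :: "real ^ ('d::finite option)"
  shows "laplacian (\<lambda>x. equiv_cubic a b c e x $ None) x = 2 * (3 * c + real CARD('d) * e) * x $ None"
proof -
  let ?g = "\<lambda>h x. (3 * c * (x $ None)\<^sup>2 + e * (\<Sum>k\<in>UNIV. (x $ Some k)\<^sup>2)) * h $ None
       + 2 * e * x $ None * (\<Sum>k\<in>UNIV. x $ Some k * h $ Some k)"
  have 1: "pd h (\<lambda>x. equiv_cubic a b c e x $ None) = ?g h" for h :: "real ^ ('d option)"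
    by (rule ext, rule pd_eq, rule equiv_cubic_None_has_derivative)
  have D: "((?g h) has_derivative (\<lambda>k. (6 * c * x $ None * k $ None + 2 * e * (\<Sum>j\<in>UNIV. x $ Some j * k $ Some j)) * h $ None
      + 2 * e * k $ None * (\<Sum>j\<in>UNIV. x $ Some j * h $ Some j)
      + 2 * e * x $ None * (\<Sum>j\<in>UNIV. k $ Some j * h $ Some j))) (at x)"
    for h :: "real ^ ('d option)"
    by (auto intro!: derivative_eq_intros component_has_derivative
      simp: fun_eq_iff sum_distrib_left sum.distrib algebra_simps)
  have G: "pd h (?g h) x = 6 * c * x $ None * (h $ None)\<^sup>2
      + 4 * e * (\<Sum>j\<in>UNIV. x $ Some j * h $ Some j) * h $ None
      + 2 * e * x $ None * (\<Sum>j\<in>UNIV. (h $ Some j)\<^sup>2)"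
    for h :: "real ^ ('d option)"
    unfolding pd_eq[OF D] by (simp add: power2_eq_square algebra_simps)
  have S1: "(\<Sum>j\<in>UNIV. x $ Some j * axis l 1 $ Some j) = (case l of None \<Rightarrow> 0 | Some l \<Rightarrow> x $ Some l)" for l :: "'d option"
    by (auto simp: axis_def if_distrib cong: if_cong split: option.splits)
  have S2: "(\<Sum>j\<in>UNIV. ((axis l 1 :: real ^ ('d option)) $ Some j)\<^sup>2) = (case l of None \<Rightarrow> 0 | Some l \<Rightarrow> 1)" for l :: "'d option"
    by (auto simp: axis_def if_distrib[of "\<lambda>x. x\<^sup>2"] cong: if_cong split: option.splits)
  show ?thesis
    unfolding laplacian_def sum_Basis_axis 1 G S1 S2 UNIV_option_conv
    by (simp add: sum.reindex sum.distrib axis_def mult_delta_right) (simp add: algebra_simps)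
qed

lemma harmonic_equiv_cubic_iff:
  "harmonic_map (equiv_cubic a b c e :: real ^ ('d::finite option) \<Rightarrow> real ^ ('d option)) \<longleftrightarrow>
     a + (real CARD('d) + 2) * b = 0 \<and> 3 * c + real CARD('d) * e = 0"
  (is "_ \<longleftrightarrow> ?A = 0 \<and> ?C = 0")
proof -
  let ?P = "equiv_cubic a b c e :: real ^ ('d option) \<Rightarrow> real ^ ('d option)"
  have "(\<forall>i x. laplacian (\<lambda>x. ?P x $ Some i) x = 0) \<longleftrightarrow> ?A = 0"
    \<comment> \<open>Evaluating at a unit axis vector, where the coordinate is 1, isolates the
      coefficient.\<close>
    unfolding laplacian_equiv_cubic_Some by (metis axis_nth mult_eq_0_iff zero_neq_numeral zero_neq_one)
  moreover have "(\<forall>x. laplacian (\<lambda>x. ?P x $ None) x = 0) \<longleftrightarrow> ?C = 0"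
    unfolding laplacian_equiv_cubic_None by (metis axis_nth mult_eq_0_iff zero_neq_numeral zero_neq_one)
  ultimately show ?thesis
    unfolding harmonic_map_def harmonic_fun_def split_option_all
    using Ck_equiv_cubic[of 2 a b c e] by blast
qed

text \<open>On the other y-axes the differential is multiplication by a t^2 + b r^2. The block for
  axis k and the t-axis has diagonal a t^2 + 3 b r^2, 3 c t^2 + e r^2 and off-diagonal entries 2 a t
  r, 2 e t r.\<close>

lemma jac_equiv_cubic_axis:
  fixes k :: "'d::finite"
  shows "jac (equiv_cubic a b c e) (join (axis k r) t) =
    (a * t\<^sup>2 + b * r\<^sup>2) ^ (CARD('d) - 1) *
    ((a * t\<^sup>2 + 3 * b * r\<^sup>2) * (3 * c * t\<^sup>2 + e * r\<^sup>2) - 4 * a * e * t\<^sup>2 * r\<^sup>2)"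
proof -
  let ?P = "equiv_cubic a b c e :: real ^ ('d option) \<Rightarrow> _" and ?x = "join (axis k r) t"
  define A where "A = jacobian ?P (at ?x)"
  have A: "A $ i $ j = pd (axis j 1) (\<lambda>x. ?P x $ i) ?x" for i j
    by (simp add: A_def jacobian_vec_pd[OF Ck_equiv_cubic])
  have x: "?x $ None = t" "?x $ Some i = (if i = k then r else 0)" for i
    by (auto simp: join_def axis_def)
  have S: "(\<Sum>i\<in>UNIV. (?x $ Some i)\<^sup>2) = r\<^sup>2"
    by (simp add: x if_distrib[of "\<lambda>x. x\<^sup>2"] cong: if_cong)
  have T: "(\<Sum>i\<in>UNIV. ?x $ Some i * axis j 1 $ Some i) = (if j = Some k then r else 0)" for j
    unfolding x by (cases j) (auto simp: axis_def mult_delta_right mult_delta_left)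
  have AS: "A $ Some i $ j = (2 * a * t * axis j 1 $ None + 2 * b * (if j = Some k then r else 0)) * (if i = k then r else 0)
      + (a * t\<^sup>2 + b * r\<^sup>2) * axis j 1 $ Some i" for i j
    unfolding A pd_eq[OF equiv_cubic_Some_has_derivative] S T by (simp only: x)
  have AN: "A $ None $ j = (3 * c * t\<^sup>2 + e * r\<^sup>2) * axis j 1 $ None + 2 * e * t * (if j = Some k then r else 0)" for j
    unfolding A pd_eq[OF equiv_cubic_None_has_derivative] S T by (simp only: x)
  have "det A = (a * t\<^sup>2 + b * r\<^sup>2) ^ (CARD('d option) - 2) *
      (A $ Some k $ Some k * A $ None $ None - A $ Some k $ None * A $ None $ Some k)"
  proof (rule det_diagonal_except_block)
    show "A $ i $ j = 0" if "i \<noteq> j" "\<not> {i, j} \<subseteq> {Some k, None}" for i j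
      using that by (cases i; cases j) (auto simp: AS AN axis_def)
    show "A $ i $ i = a * t\<^sup>2 + b * r\<^sup>2" if "i \<notin> {Some k, None}" for i
      using that by (cases i) (auto simp: AS axis_def)
  qed simp
  also have "CARD('d option) - 2 = CARD('d) - 1" by simp
  also have "A $ Some k $ Some k * A $ None $ None - A $ Some k $ None * A $ None $ Some k
    = (a * t\<^sup>2 + 3 * b * r\<^sup>2) * (3 * c * t\<^sup>2 + e * r\<^sup>2) - 4 * a * e * t\<^sup>2 * r\<^sup>2"
    by (simp add: AS AN axis_def power2_eq_square algebra_simps)
  finally show ?thesis by (simp add: jac_def A_def)
qed

lemma equiv_cubic_differentiable: "equiv_cubic a b c e differentiable (at x)"
  by (rule differentiableI) (rule has_derivative_vec_pd[OF Ck_equiv_cubic])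

lemma jac_equiv_cubic:
  fixes y :: "real ^ 'd::finite"
  shows "jac (equiv_cubic a b c e) (join y t) =
    (a * t\<^sup>2 + b * (norm y)\<^sup>2) ^ (CARD('d) - 1) *
    ((a * t\<^sup>2 + 3 * b * (norm y)\<^sup>2) * (3 * c * t\<^sup>2 + e * (norm y)\<^sup>2) - 4 * a * e * t\<^sup>2 * (norm y)\<^sup>2)"
proof -
  \<comment> \<open>\<open>undefined\<close> just names some coordinate; the argument works for any
    index.\<close>
  let ?k = "undefined :: 'd"
  obtain R :: "real ^ 'd ^ 'd" where R: "orthogonal_matrix R" "R *v y = axis ?k (norm y)"
    using obtain_rotation[of y "axis ?k (norm y)"] by (auto simp: norm_eq_sqrt_inner inner_axis_axis)
  have "jac (equiv_cubic a b c e) (join y t) = jac (equiv_cubic a b c e) (join (axis ?k (norm y)) t)"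
    using jac_equivariant[OF equivariant_equiv_cubic equiv_cubic_differentiable R(1), of a b c e "join y t"] R(2)
    by simp
  then show ?thesis by (simp add: jac_equiv_cubic_axis)
qed

lemma jac_harm_cubic:
  fixes y :: "real ^ 'd::finite"
  shows "jac (harm_cubic a c) (join y t) =
      a ^ CARD('d) * c * (t\<^sup>2 - (norm y)\<^sup>2 / (real CARD('d) + 2)) ^ (CARD('d) - 1) *
      (3 * (real CARD('d) * (real CARD('d) + 2) * t ^ 4 + 6 * (norm y)\<^sup>2 * t\<^sup>2 + 3 * (norm y) ^ 4)
         / (real CARD('d) * (real CARD('d) + 2)))"
proof -
  define d N T where "d = real CARD('d)" and "N = (norm y)\<^sup>2" and "T = t\<^sup>2"
  have d: "d > 0" by (simp add: d_def)
  have pow: "a ^ CARD('d) = a ^ (CARD('d) - 1) * a" by (simp flip: power_Suc2)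
  have NT: "(norm y) ^ 4 = N\<^sup>2" "t ^ 4 = T\<^sup>2" by (simp_all add: N_def T_def flip: power_mult)
  have "a * T + - a / (d + 2) * N = a * (T - N / (d + 2))"
    by (simp add: algebra_simps)
  \<comment> \<open>The mixed coefficient is 4/d - 1/d - 3/(d + 2) = 6/(d (d + 2)). It is positive,
    which is why the last factor of the Jacobian has no cancellation.\<close>
  moreover have "(a * T + 3 * (- a / (d + 2)) * N) * (3 * c * T + (- 3 * c / d) * N) - 4 * a * (- 3 * c / d) * T * N
      = a * c * (3 * (d * (d + 2) * T\<^sup>2 + 6 * N * T + 3 * N\<^sup>2) / (d * (d + 2)))"
    using d by (simp add: divide_simps add_eq_0_iff) (simp add: power2_eq_square algebra_simps)
  ultimately show ?thesis
    unfolding harm_cubic_eq_equiv_cubic jac_equiv_cubic NT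
    by (simp add: power_mult_distrib pow flip: d_def N_def T_def)
qed

section \<open>The form of equivariant cubics\<close>

text \<open>A monomial containing another y-coordinate vanishes on the plane; any other is
  determined there by its exponent of s. Coefficients are chosen for each monomial and then
  added.\<close>

lemma homogeneous_poly_on_plane:
  fixes f :: "real ^ ('d::finite option) \<Rightarrow> real"
  assumes "homogeneous_poly n f"
  shows "\<exists>a. \<forall>s t. f (join (axis k s) t) = (\<Sum>m\<le>n. a m * s ^ m * t ^ (n - m))"
proof -
  let ?x = "\<lambda>s t. join (axis k s) t :: real ^ ('d option)"
  let ?S = "{\<alpha> :: 'd option \<Rightarrow> nat. (\<Sum>i\<in>UNIV. \<alpha> i) = n}"
  obtain c where "\<forall>x. f x = (\<Sum>\<alpha>\<in>?S. c \<alpha> * (\<Prod>i\<in>UNIV. (x $ i) ^ \<alpha> i))"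
    using assms unfolding homogeneous_poly_def by (rule exE)
  then have c: "f x = (\<Sum>\<alpha>\<in>?S. c \<alpha> * (\<Prod>i\<in>UNIV. (x $ i) ^ \<alpha> i))" for x
    by (rule spec)
  have "\<exists>a. \<forall>s t. c \<alpha> * (\<Prod>i\<in>UNIV. (?x s t $ i) ^ \<alpha> i) = (\<Sum>m\<le>n. a m * s ^ m * t ^ (n - m))"
    if \<alpha>: "\<alpha> \<in> ?S" for \<alpha>
  proof (cases "\<exists>j. j \<noteq> k \<and> \<alpha> (Some j) \<noteq> 0")
    case True
    then obtain j where "j \<noteq> k" "\<alpha> (Some j) \<noteq> 0" by blast
    then have "(?x s t $ Some j) ^ \<alpha> (Some j) = 0" for s t
      by (simp add: join_def axis_def)
    then have "(\<Prod>i\<in>UNIV. (?x s t $ i) ^ \<alpha> i) = 0" for s t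
      by (intro prod_zero) auto
    then show ?thesis by (intro exI[of _ "\<lambda>_. 0"]) simp
  next
    case False
    have p: "(\<Prod>i\<in>UNIV. (?x s t $ i) ^ \<alpha> i) = t ^ \<alpha> None * s ^ \<alpha> (Some k)" for s t
    proof -
      have "(\<Prod>j\<in>UNIV. (?x s t $ Some j) ^ \<alpha> (Some j)) = (\<Prod>j\<in>UNIV. if j = k then s ^ \<alpha> (Some k) else 1)"
        by (rule prod.cong) (use False in \<open>auto simp: join_def axis_def\<close>)
      then have "(\<Prod>j\<in>UNIV. (?x s t $ Some j) ^ \<alpha> (Some j)) = s ^ \<alpha> (Some k)"
        by simp
      then show ?thesis
        by (simp add: UNIV_option_conv prod.reindex) (simp add: join_def)
    qed
    have "(\<Sum>j\<in>UNIV. \<alpha> (Some j)) = (\<Sum>j\<in>UNIV. if j = k then \<alpha> (Some k) else 0)"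
      by (rule sum.cong) (use False in auto)
    then have "\<alpha> None + \<alpha> (Some k) = n"
      using \<alpha> by (simp add: UNIV_option_conv sum.reindex)
    then have "\<alpha> (Some k) \<le> n" "\<alpha> None = n - \<alpha> (Some k)" by auto
    then have "c \<alpha> * (\<Prod>i\<in>UNIV. (?x s t $ i) ^ \<alpha> i)
        = (\<Sum>m\<le>n. (if m = \<alpha> (Some k) then c \<alpha> else 0) * s ^ m * t ^ (n - m))" for s t
      unfolding p by (simp add: mult_delta_left)
    then show ?thesis by (intro exI allI)
  qed
  then have "\<forall>\<alpha>\<in>?S. \<exists>a. \<forall>s t. c \<alpha> * (\<Prod>i\<in>UNIV. (?x s t $ i) ^ \<alpha> i) = (\<Sum>m\<le>n. a m * s ^ m * t ^ (n - m))"
    by (rule ballI)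
  from bchoice[OF this] obtain a where
    a: "\<forall>\<alpha>\<in>?S. \<forall>s t. c \<alpha> * (\<Prod>i\<in>UNIV. (?x s t $ i) ^ \<alpha> i) = (\<Sum>m\<le>n. a \<alpha> m * s ^ m * t ^ (n - m))"
    by (rule exE)
  have "f (?x s t) = (\<Sum>m\<le>n. (\<Sum>\<alpha>\<in>?S. a \<alpha> m) * s ^ m * t ^ (n - m))" for s t
  proof -
    have "f (?x s t) = (\<Sum>\<alpha>\<in>?S. \<Sum>m\<le>n. a \<alpha> m * s ^ m * t ^ (n - m))"
      unfolding c by (rule sum.cong[OF refl]) (use a in blast)
    also have "\<dots> = (\<Sum>m\<le>n. \<Sum>\<alpha>\<in>?S. a \<alpha> m * s ^ m * t ^ (n - m))"
      by (rule sum.swap)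
    finally show ?thesis by (simp only: sum_distrib_right)
  qed
  then show ?thesis by (intro exI allI)
qed

definition coord_reflection :: "'d \<Rightarrow> real ^ 'd ^ 'd" where
  "coord_reflection i = (\<chi> p q. if p = q then (if p = i then - 1 else 1) else 0)"

lemma coord_reflection_mult:
  "(coord_reflection i *v y) $ p = (if p = i then - (y $ p) else y $ p)"
  by (simp add: coord_reflection_def matrix_vector_mult_def mult_delta_left)

lemma orthogonal_coord_reflection: "orthogonal_matrix (coord_reflection i)"
proof -
  have "transpose (coord_reflection i) = coord_reflection i"
    by (auto simp: coord_reflection_def transpose_def vec_eq_iff)
  moreover have "coord_reflection i ** coord_reflection i = mat 1"
    by (rule matrix_eq[THEN iffD2]) (simp add: vec_eq_iff coord_reflection_mult flip: matrix_vector_mul_assoc)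
  ultimately show ?thesis by (simp add: orthogonal_matrix)
qed

text \<open>An orthogonal matrix carries \<open>y\<close> onto a coordinate axis, so the map is determined by its
  values on the plane spanned by that axis and the \<open>t\<close>-axis. Reflections in the other coordinates
  fix this plane, hence the plane is mapped to itself, and reflection in the axis itself decides
  the parities.\<close>

lemma equivariant_cubic_form:
  fixes P :: "real ^ ('d::finite option) \<Rightarrow> real ^ ('d option)"
  assumes P: "equivariant P" "homogeneous_cubic P"
  shows "\<exists>a b c e. P = equiv_cubic a b c e"
proof -
  let ?k = "undefined :: 'd"
  let ?x = "\<lambda>s t. join (axis ?k s) t :: real ^ ('d option)"
  have eqv: "P (act R x) = act R (P x)" if "orthogonal_matrix R" for R x
    using P(1) that by (simp add: equivariant_def)
  have refl: "coord_reflection i *v axis ?k s = axis ?k (if i = ?k then - s else s)" for i s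
    by (auto simp: vec_eq_iff coord_reflection_mult axis_def)
  have act_None: "act R x $ None = x $ None" and
    act_Some: "act (coord_reflection i) x $ Some j = (if j = i then - (x $ Some j) else x $ Some j)" for R x i j
    by (simp_all add: act_def join_def tcoord_def coord_reflection_mult ycoord_def)
  have off: "P (?x s t) $ Some i = 0" if "i \<noteq> ?k" for i s t
    using arg_cong[OF eqv[OF orthogonal_coord_reflection, of i "?x s t"], of "\<lambda>v. v $ Some i"] that
    by (simp add: refl act_Some)
  have odd: "P (?x (- s) t) $ Some ?k = - P (?x s t) $ Some ?k" for s t
    using arg_cong[OF eqv[OF orthogonal_coord_reflection, of ?k "?x s t"], of "\<lambda>v. v $ Some ?k"]
    by (simp add: refl act_Some)
  have even: "P (?x (- s) t) $ None = P (?x s t) $ None" for s t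
    using arg_cong[OF eqv[OF orthogonal_coord_reflection, of ?k "?x s t"], of "\<lambda>v. v $ None"]
    by (simp add: refl act_None)
  have form: "\<exists>A B C D. \<forall>s t. P (?x s t) $ j = A * s ^ 3 + B * s\<^sup>2 * t + C * s * t\<^sup>2 + D * t ^ 3" for j
  proof -
    have "homogeneous_poly 3 (\<lambda>x. P x $ j)" using P(2) by (simp add: homogeneous_cubic_def)
    from homogeneous_poly_on_plane[OF this] obtain a where
      "\<And>s t. P (?x s t) $ j = (\<Sum>m\<le>3. a m * s ^ m * t ^ (3 - m))" by blast
    then have "P (?x s t) $ j = a 3 * s ^ 3 + a 2 * s\<^sup>2 * t + a 1 * s * t\<^sup>2 + a 0 * t ^ 3" for s t
      by (simp add: eval_nat_numeral)
    then show ?thesis by blast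
  qed
  obtain A B C D where g: "\<And>s t. P (?x s t) $ Some ?k = A * s ^ 3 + B * s\<^sup>2 * t + C * s * t\<^sup>2 + D * t ^ 3"
    using form[of "Some ?k"] by (elim exE) (rule that, blast)
  obtain A' B' C' D' where h: "\<And>s t. P (?x s t) $ None = A' * s ^ 3 + B' * s\<^sup>2 * t + C' * s * t\<^sup>2 + D' * t ^ 3"
    using form[of None] by (elim exE) (rule that, blast)
  \<comment> \<open>Parity in s leaves s^3 and s t^2 in the first binary cubic, t^3 and s^2 t in the
    second; their coefficients, in the order of the parameters of \<open>equiv_cubic\<close>, are C,
    A, D', B'.\<close>
  let ?E = "equiv_cubic C A D' B' :: real ^ ('d option) \<Rightarrow> _"
  have plane: "P (?x s t) = ?E (?x s t)" for s t
  proof -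
    have S: "(\<Sum>i\<in>UNIV. (?x s t $ Some i)\<^sup>2) = s\<^sup>2"
      by (simp add: join_def axis_def if_distrib[of "\<lambda>x. x\<^sup>2"] cong: if_cong)
    have x: "?x s t $ None = t" "?x s t $ Some i = (if i = ?k then s else 0)" for i
      by (auto simp: join_def axis_def)
    have "P (?x s t) $ Some ?k = (C * t\<^sup>2 + A * s\<^sup>2) * s"
      using odd[of s t] unfolding g by (simp add: power2_eq_square power3_eq_cube algebra_simps)
    moreover have "P (?x s t) $ None = D' * t ^ 3 + B' * t * s\<^sup>2"
      using even[of s t] unfolding h by (simp add: power2_eq_square power3_eq_cube algebra_simps)
    moreover have "?E (?x s t) $ Some i = (C * t\<^sup>2 + A * s\<^sup>2) * (if i = ?k then s else 0)" for i
      unfolding equiv_cubic_Some S by (simp only: x)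
    moreover have "?E (?x s t) $ None = D' * t ^ 3 + B' * t * s\<^sup>2"
      unfolding equiv_cubic_None S by (simp only: x)
    ultimately have "P (?x s t) $ i = ?E (?x s t) $ i" for i
      using off[of _ s t] by (cases i) auto
    then show ?thesis by (simp add: vec_eq_iff)
  qed
  have "P x = ?E x" for x
  proof -
    obtain R :: "real ^ 'd ^ 'd" where R: "orthogonal_matrix R" "R *v ycoord x = axis ?k (norm (ycoord x))"
      using obtain_rotation[of "ycoord x" "axis ?k (norm (ycoord x))"]
      by (auto simp: norm_eq_sqrt_inner inner_axis_axis)
    have "P (act R x) = ?E (act R x)"
      using plane by (simp add: act_def R(2))
    then have "act R (P x) = act R (?E x)"
      using eqv[OF R(1)] equivariant_equiv_cubic[of C A D' B'] R(1) unfolding equivariant_def by metis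
    then show ?thesis by (metis act_transpose_act R(1))
  qed
  then show ?thesis by blast
qed

lemma eqv_harm_cubic_form:
  fixes P :: "real ^ ('d::finite option) \<Rightarrow> real ^ ('d option)"
  assumes "eqv_harm_cubic P"
  shows "\<exists>a c. P = harm_cubic a c"
proof -
  obtain a b c e where P: "P = equiv_cubic a b c e"
    using assms equivariant_cubic_form unfolding eqv_harm_cubic_def by blast
  have "harmonic_map (equiv_cubic a b c e :: real ^ ('d option) \<Rightarrow> real ^ ('d option))"
    using assms P by (simp add: eqv_harm_cubic_def)
  then have "a + (real CARD('d) + 2) * b = 0" "3 * c + real CARD('d) * e = 0"
    by (simp_all add: harmonic_equiv_cubic_iff)
  then have "b = - a / (real CARD('d) + 2)" "e = - 3 * c / real CARD('d)"
    by (simp_all add: field_simps)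
  then show ?thesis
    unfolding P harm_cubic_eq_equiv_cubic by blast
qed

section \<open>Quasiregularity and the zero set of the Jacobian\<close>

lemma linear_hyperplane_reflection: "linear (hyperplane_reflection v)"
  by (auto simp: hyperplane_reflection_def algebra_simps intro!: linearI)

lemma hyperplane_reflection_involution:
  "norm v = 1 \<Longrightarrow> hyperplane_reflection v (hyperplane_reflection v x) = x"
  by (simp add: hyperplane_reflection_def inner_diff_left dot_square_norm algebra_simps)

text \<open>Composing with a reflection of the target multiplies the differential by an invertible
  matrix, so the determinant stays zero and the differential stays nonzero. The criterion for the
  sense-preserving case thus covers both alternatives.\<close>

lemma not_quasiregular_critical_point:
  fixes f :: "real ^ 'n \<Rightarrow> real ^ 'n"
  assumes f: "\<And>i. Ck 1 (\<lambda>x. f x $ i)" and crit: "jac f x = 0" "frechet_derivative f (at x) \<noteq> (\<lambda>h. 0)"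
  shows "\<not> quasiregular f"
proof
  assume "quasiregular f"
  moreover have "\<not> sense_preserving_quasiregular f"
    using sense_preserving_quasiregular_critical[OF f _ crit(1)] crit(2) by blast
  ultimately obtain v where v: "norm v = 1" and
    qr: "sense_preserving_quasiregular (hyperplane_reflection v \<circ> f)"
    unfolding quasiregular_def by blast
  let ?T = "hyperplane_reflection v" and ?D = "frechet_derivative f (at x)"
  have D: "(f has_derivative ?D) (at x)"
    using has_derivative_vec_pd[OF f] by (simp only: frechet_derivative_vec_pd[OF f])
  have "((\<lambda>x. ?T (f x)) has_derivative (\<lambda>h. ?T (?D h))) (at x)"
    by (rule has_derivative_compose[OF D linear_imp_has_derivative[OF linear_hyperplane_reflection]])
  then have TD: "frechet_derivative (?T \<circ> f) (at x) = ?T \<circ> ?D"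
    by (simp add: frechet_derivative_at[symmetric] comp_def)
  have "frechet_derivative (?T \<circ> f) (at x) = (\<lambda>h. 0)"
  proof (rule sense_preserving_quasiregular_critical[OF _ qr])
    have "(?T \<circ> f) x $ i = f x $ i - 2 * (\<Sum>j\<in>UNIV. f x $ j * v $ j) * v $ i" for i x
      by (simp add: hyperplane_reflection_def inner_vec_def)
    then show "Ck 1 (\<lambda>x. (?T \<circ> f) x $ i)" for i
      by (simp only:) (intro Ck_diff Ck_mult Ck_sum Ck_const f)
    have "matrix (?T \<circ> ?D) = matrix ?T ** matrix ?D"
      using has_derivative_linear[OF D] linear_hyperplane_reflection[of v]
      by (intro matrix_compose) (simp_all add: linear_matrix_vector_mul_eq)
    then show "jac (?T \<circ> f) x = 0"
      using crit(1) by (simp add: jac_def jacobian_def TD det_mul)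
  qed
  then have "?T (?D h) = 0" for h
    unfolding TD by (metis comp_apply)
  then have "?D h = 0" for h
    by (metis hyperplane_reflection_involution[OF v] linear_0 linear_hyperplane_reflection)
  then show False using crit(2) by blast
qed

text \<open>Euler's identity: \<open>3 P(x)\<close> is the derivative of \<open>P\<close> at \<open>x\<close> in the direction \<open>x\<close>.\<close>

lemma equiv_cubic_derivative_nonzero:
  assumes "equiv_cubic a b c e x \<noteq> 0"
  shows "frechet_derivative (equiv_cubic a b c e) (at x) \<noteq> (\<lambda>h. 0)"
proof
  let ?P = "equiv_cubic a b c e"
  assume 0: "frechet_derivative ?P (at x) = (\<lambda>h. 0)"
  have "(?P has_derivative frechet_derivative ?P (at x)) (at x)"
    using equiv_cubic_differentiable frechet_derivative_works by blast
  \<comment> \<open>Writing the point as \<open>1 *\<^sub>R x\<close> lets the chain rule run along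
    the ray through x at parameter 1.\<close>
  then have D: "(?P has_derivative (\<lambda>h. 0)) (at (1 *\<^sub>R x))" by (simp add: 0)
  have "((\<lambda>s. s *\<^sub>R x) has_derivative (\<lambda>h. h *\<^sub>R x)) (at 1)"
    by (auto intro!: derivative_eq_intros)
  from has_derivative_compose[OF this D]
  have "((\<lambda>s. s ^ 3 *\<^sub>R ?P x) has_derivative (\<lambda>h. 0)) (at 1)"
    by (simp add: equiv_cubic_scale)
  moreover have "((\<lambda>s. s ^ 3 *\<^sub>R ?P x) has_derivative (\<lambda>h. (3 * h) *\<^sub>R ?P x)) (at 1)"
    by (auto intro!: derivative_eq_intros)
  ultimately have "(\<lambda>h. 0) = (\<lambda>h. (3 * h) *\<^sub>R ?P x)"
    by (rule has_derivative_unique)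
  from fun_cong[OF this, of 1] show False using assms by simp
qed

text \<open>The factor that vanishes on the cone multiplies y in the map and enters the Jacobian to
  the power d - 1. What remains of the map depends on t alone.\<close>

lemma harm_cubic_on_cone:
  fixes y :: "real ^ 'd::finite"
  assumes "(norm y)\<^sup>2 = (real CARD('d) + 2) * t\<^sup>2"
  shows "harm_cubic a c (join y t) = join 0 (c * t ^ 3 * (1 - 3 * (real CARD('d) + 2) / real CARD('d)))"
    and "CARD('d) \<ge> 2 \<Longrightarrow> jac (harm_cubic a c) (join y t) = 0"
proof -
  have z: "t\<^sup>2 - (norm y)\<^sup>2 / (real CARD('d) + 2) = 0"
    using assms by (simp add: field_simps)
  have "c * (t ^ 3 - 3 / r * t * ((r + 2) * t\<^sup>2)) = c * t ^ 3 * (1 - 3 * (r + 2) / r)" for r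
    by (cases "r = 0") (simp_all add: power2_eq_square power3_eq_cube field_simps)
  then show "harm_cubic a c (join y t) = join 0 (c * t ^ 3 * (1 - 3 * (real CARD('d) + 2) / real CARD('d)))"
    unfolding harm_cubic_def Let_def ycoord_join tcoord_join z unfolding assms by simp
  show "jac (harm_cubic a c) (join y t) = 0" if "CARD('d) \<ge> 2"
    unfolding jac_harm_cubic z using that by simp
qed

lemma harm_cubic_critical_point:
  fixes a c :: real
  assumes "(harm_cubic a c :: real ^ ('d::finite option) \<Rightarrow> real ^ ('d option)) \<noteq> (\<lambda>x. 0)" "CARD('d::finite) \<ge> 2"
  obtains x :: "real ^ ('d::finite option)" where "jac (harm_cubic a c) x = 0" "harm_cubic a c x \<noteq> 0"
proof (cases "a = 0 \<or> c = 0")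
  case True
  obtain x :: "real ^ ('d option)" where "harm_cubic a c x \<noteq> 0" using assms(1) by auto
  moreover have "jac (harm_cubic a c) x = 0"
    using True jac_harm_cubic[of a c "ycoord x" "tcoord x"] by auto
  ultimately show ?thesis using that by blast
next
  case False
  \<comment> \<open>This length puts (y, 1) on the cone.\<close>
  define y :: "real ^ 'd" where "y = axis undefined (sqrt (real CARD('d) + 2))"
  have y: "(norm y)\<^sup>2 = (real CARD('d) + 2) * 1\<^sup>2"
    by (simp add: y_def norm_eq_sqrt_inner inner_axis_axis)
  have "1 - 3 * (real CARD('d) + 2) / real CARD('d) \<noteq> 0"
    by (simp add: field_simps)
  then show ?thesis
    using that[of "join y 1"] harm_cubic_on_cone[OF y, of a c] assms(2) False by simp
qed

section \<open>Sign and zeros of the Jacobian\<close>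

lemma jac_factor_pos:
  fixes y :: "real ^ 'd::finite"
  assumes "join y t \<noteq> 0"
  shows "3 * (real CARD('d) * (real CARD('d) + 2) * t ^ 4 + 6 * (norm y)\<^sup>2 * t\<^sup>2 + 3 * (norm y) ^ 4)
     / (real CARD('d) * (real CARD('d) + 2)) > 0"
proof -
  have "real CARD('d) * (real CARD('d) + 2) * t ^ 4 + 6 * (norm y)\<^sup>2 * t\<^sup>2 + 3 * (norm y) ^ 4 > 0"
  proof (cases "t = 0")
    case True
    then show ?thesis using assms by simp
  next
    case False
    then have "t ^ 4 > 0" by simp
    then have "real CARD('d) * (real CARD('d) + 2) * t ^ 4 > 0" by simp
    then show ?thesis by (simp add: add_pos_nonneg)
  qed
  then show ?thesis by (intro divide_pos_pos mult_pos_pos) auto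
qed

lemma jac_harm_cubic_eq_0_iff:
  fixes x :: "real ^ ('d::finite option)"
  assumes "a ^ CARD('d) * c \<noteq> 0" "CARD('d) \<ge> 2" "x \<noteq> 0"
  shows "jac (harm_cubic a c) x = 0 \<longleftrightarrow> (norm (ycoord x))\<^sup>2 = (real CARD('d) + 2) * (tcoord x)\<^sup>2"
proof -
  have "join (ycoord x) (tcoord x) \<noteq> 0" using assms(3) by (simp only: join_coords) simp
  from jac_factor_pos[OF this] have "jac (harm_cubic a c) (join (ycoord x) (tcoord x)) = 0 \<longleftrightarrow>
      (tcoord x)\<^sup>2 - (norm (ycoord x))\<^sup>2 / (real CARD('d) + 2) = 0"
    unfolding jac_harm_cubic using assms(1,2) by (simp only: mult_eq_0_iff power_eq_0_iff) auto
  also have "\<dots> \<longleftrightarrow> (norm (ycoord x))\<^sup>2 = (real CARD('d) + 2) * (tcoord x)\<^sup>2"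
    by (auto simp: field_simps)
  finally show ?thesis by simp
qed

text \<open>Substituting |y|^2 = 1 - t^2 turns the cone equation into (d + 3) t^2 = 1.\<close>

lemma sphere_latitude_iff:
  fixes x :: "real ^ ('d::finite option)"
  assumes "x \<in> sphere 0 1"
  shows "(norm (ycoord x))\<^sup>2 = (real CARD('d) + 2) * (tcoord x)\<^sup>2 \<longleftrightarrow>
     tcoord x = 1 / sqrt (real CARD('d) + 3) \<or> tcoord x = - 1 / sqrt (real CARD('d) + 3)"
proof -
  let ?r = "1 / sqrt (real CARD('d) + 3)"
  have "(norm (ycoord x))\<^sup>2 + (tcoord x)\<^sup>2 = 1"
    using norm_join[of "ycoord x" "tcoord x"] assms by simp
  then have "(norm (ycoord x))\<^sup>2 = (real CARD('d) + 2) * (tcoord x)\<^sup>2 \<longleftrightarrow> (real CARD('d) + 3) * (tcoord x)\<^sup>2 = 1"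
    by (auto simp: algebra_simps)
  also have "\<dots> \<longleftrightarrow> (tcoord x)\<^sup>2 = ?r\<^sup>2"
    by (auto simp: power_divide field_simps)
  also have "\<dots> \<longleftrightarrow> tcoord x = ?r \<or> tcoord x = - 1 / sqrt (real CARD('d) + 3)"
    by (simp add: power2_eq_iff)
  finally show ?thesis .
qed

text \<open>The odd power d - 1 has base 1 at the pole (0, 1) and base -1/(d + 2) on the equator t =
  0. The two Jacobians therefore have opposite signs, and the sign of a^d c decides which is
  positive.\<close>

lemma jac_harm_cubic_changes_sign:
  assumes "even CARD('d::finite)" "a * c \<noteq> 0"
  shows "(\<exists>x \<in> sphere (0 :: real ^ ('d::finite option)) 1. jac (harm_cubic a c) x > 0) \<and>
     (\<exists>x \<in> sphere (0 :: real ^ ('d option)) 1. jac (harm_cubic a c) x < 0)"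
proof -
  let ?p = "join 0 1 :: real ^ ('d option)" and ?q = "join (axis undefined 1) 0 :: real ^ ('d option)"
  let ?Q = "a ^ CARD('d) * c"
  have "(norm ?p)\<^sup>2 = 1" "(norm ?q)\<^sup>2 = 1"
    by (simp_all only: norm_join) (simp_all add: norm_eq_sqrt_inner inner_axis_axis)
  then have s: "?p \<in> sphere 0 1" "?q \<in> sphere 0 1"
    by (simp_all add: power2_eq_1_iff) (metis norm_ge_zero not_one_le_zero neg_0_le_iff_le order_trans zero_le_one)+
  have Q: "?Q \<noteq> 0" using assms(2) by simp
  obtain u v where u: "u > 0" "jac (harm_cubic a c) ?p = ?Q * u"
    and v: "v > 0" "jac (harm_cubic a c) ?q = - (?Q * v)"
  proof
    let ?r = "real CARD('d)"
    show "jac (harm_cubic a c) ?p = ?Q * 3"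
      unfolding jac_harm_cubic by simp
    have "odd (CARD('d) - 1)" using assms(1) by simp
    then have "(0\<^sup>2 - (norm (axis undefined 1 :: real ^ 'd))\<^sup>2 / (?r + 2)) ^ (CARD('d) - 1) = - ((1 / (?r + 2)) ^ (CARD('d) - 1))"
      by (simp add: norm_eq_sqrt_inner inner_axis_axis power_minus_odd flip: minus_divide_left)
    then show "jac (harm_cubic a c) ?q = - (?Q * ((1 / (?r + 2)) ^ (CARD('d) - 1) * (9 / (?r * (?r + 2)))))"
      unfolding jac_harm_cubic by (simp add: norm_eq_sqrt_inner inner_axis_axis)
    show "(1 / (?r + 2)) ^ (CARD('d) - 1) * (9 / (?r * (?r + 2))) > 0" by simp
  qed simp
  show ?thesis
  proof (cases "?Q > 0")
    case True
    then have "jac (harm_cubic a c) ?p > 0" "jac (harm_cubic a c) ?q < 0"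
      using u v by simp_all
    then show ?thesis using s by blast
  next
    case False
    then have "?Q < 0" using Q by linarith
    then have "jac (harm_cubic a c) ?p < 0" "jac (harm_cubic a c) ?q > 0"
      using u v by (simp_all add: mult_neg_pos)
    then show ?thesis using s by blast
  qed
qed

lemma jac_harm_cubic_nonneg:
  fixes x :: "real ^ ('d::finite option)"
  assumes "odd CARD('d)" "a ^ CARD('d) * c > 0"
  shows "jac (harm_cubic a c) x \<ge> 0"
proof -
  have "a ^ CARD('d) * c \<ge> 0" using assms(2) by simp
  moreover have "((tcoord x)\<^sup>2 - (norm (ycoord x))\<^sup>2 / (real CARD('d) + 2)) ^ (CARD('d) - 1) \<ge> 0"
    using assms(1) by (intro zero_le_even_power) simp
  ultimately have "jac (harm_cubic a c) (join (ycoord x) (tcoord x)) \<ge> 0"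
    unfolding jac_harm_cubic by (intro mult_nonneg_nonneg[OF mult_nonneg_nonneg]) auto
  then show ?thesis by simp
qed

text \<open>The points (y, 1) and (-y, 1) of the cone are distinct and have the same image.\<close>

lemma harm_cubic_not_inj: "\<not> inj (harm_cubic a c :: real ^ ('d::finite option) \<Rightarrow> real ^ ('d option))"
proof
  assume inj: "inj (harm_cubic a c :: real ^ ('d option) \<Rightarrow> real ^ ('d option))"
  define y :: "real ^ 'd" where "y = axis undefined (sqrt (real CARD('d) + 2))"
  have y: "(norm y)\<^sup>2 = (real CARD('d) + 2) * 1\<^sup>2"
    by (simp add: y_def norm_eq_sqrt_inner inner_axis_axis)
  then have y': "(norm (- y))\<^sup>2 = (real CARD('d) + 2) * 1\<^sup>2" by simp
  have "harm_cubic a c (join y 1) = harm_cubic a c (join (- y) 1)"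
    by (simp only: harm_cubic_on_cone(1)[OF y] harm_cubic_on_cone(1)[OF y'])
  then have "join y 1 = join (- y) 1" by (rule injD[OF inj])
  then have "y = - y" by simp
  then have "2 *\<^sub>R y = 0" by (metis scaleR_2 add.right_inverse)
  then have "y = 0" by simp
  with y show False by simp
qed

text \<open>A single latitude, with (d + 3) t^2 = 1, serves all a and c at once, including the
  degenerate cases.\<close>

lemma sphere_cone_point:
  assumes "CARD('d::finite) \<ge> 2"
  shows "\<exists>x \<in> sphere (0 :: real ^ ('d::finite option)) 1. jac (harm_cubic a c) x = 0"
proof
  define t where "t = 1 / sqrt (real CARD('d) + 3)"
  define y :: "real ^ 'd" where "y = axis undefined (sqrt (real CARD('d) + 2) * t)"
  have y: "(norm y)\<^sup>2 = (real CARD('d) + 2) * t\<^sup>2"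
    by (simp add: y_def norm_eq_sqrt_inner inner_axis_axis power2_eq_square)
  show "jac (harm_cubic a c) (join y t) = 0" by (rule harm_cubic_on_cone(2)[OF y assms])
  have "(norm (join y t))\<^sup>2 = (real CARD('d) + 3) * t\<^sup>2"
    by (simp add: norm_join y algebra_simps)
  also have "\<dots> = 1" by (simp add: t_def power_divide)
  finally have "norm (join y t) = 1" by (simp add: power2_eq_1_iff) (use norm_ge_zero[of "join y t"] in linarith)
  then show "join y t \<in> sphere 0 1" by simp
qed

theorem theorem6p3:
  fixes d n :: nat
  assumes "d = CARD('d::finite)" and "d \<ge> 2" and "n = d + 1"
  shows
    "(\<forall>P :: real ^ ('d option) \<Rightarrow> real ^ ('d option).
        equivariant P \<and> homogeneous_cubic P \<longrightarrow> (\<exists>a b c e. P = equiv_cubic a b c e)) \<and>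
     (\<forall>a b c e. harmonic_map (equiv_cubic a b c e :: real ^ ('d option) \<Rightarrow> real ^ ('d option)) \<longleftrightarrow>
        a + (real d + 2) * b = 0 \<and> 3 * c + real d * e = 0) \<and>
     (\<forall>P :: real ^ ('d option) \<Rightarrow> real ^ ('d option).
        eqv_harm_cubic P \<longrightarrow> (\<exists>a c. P = harm_cubic a c)) \<and>
     (\<forall>a c t. \<forall>y :: real ^ 'd.
        jac (harm_cubic a c) (join y t) =
          a ^ d * c * (t\<^sup>2 - (norm y)\<^sup>2 / (real d + 2)) ^ (d - 1) *
          (3 * (real d * (real d + 2) * t ^ 4 + 6 * (norm y)\<^sup>2 * t\<^sup>2 + 3 * (norm y) ^ 4)
             / (real d * (real d + 2)))) \<and>
     (\<forall>t. \<forall>y :: real ^ 'd. join y t \<noteq> 0 \<longrightarrow>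
        3 * (real d * (real d + 2) * t ^ 4 + 6 * (norm y)\<^sup>2 * t\<^sup>2 + 3 * (norm y) ^ 4)
          / (real d * (real d + 2)) > 0) \<and>
     (\<forall>P :: real ^ ('d option) \<Rightarrow> real ^ ('d option).
        eqv_harm_cubic P \<and> P \<noteq> (\<lambda>x. 0) \<longrightarrow> \<not> (\<forall>x \<in> sphere 0 1. jac P x > 0)) \<and>
     (\<forall>a c. odd n \<and> a * c \<noteq> 0 \<longrightarrow>
        (\<exists>x \<in> sphere (0 :: real ^ ('d option)) 1. jac (harm_cubic a c) x > 0) \<and>
        (\<exists>x \<in> sphere (0 :: real ^ ('d option)) 1. jac (harm_cubic a c) x < 0)) \<and>
     (\<forall>a c. even n \<and> a ^ d * c > 0 \<longrightarrow>
        (\<forall>x :: real ^ ('d option). jac (harm_cubic a c) x \<ge> 0) \<and>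
        {x \<in> sphere (0 :: real ^ ('d option)) 1. jac (harm_cubic a c) x = 0} =
          {join y t | y t. (norm y)\<^sup>2 = (real d + 2) * t\<^sup>2 \<and> (norm y)\<^sup>2 + t\<^sup>2 = 1} \<and>
        {x \<in> sphere (0 :: real ^ ('d option)) 1. jac (harm_cubic a c) x = 0} =
          {x \<in> sphere 0 1. tcoord x = 1 / sqrt (real d + 3)} \<union>
          {x \<in> sphere 0 1. tcoord x = - 1 / sqrt (real d + 3)}) \<and>
     (\<forall>P :: real ^ ('d option) \<Rightarrow> real ^ ('d option).
        eqv_harm_cubic P \<and> P \<noteq> (\<lambda>x. 0) \<longrightarrow>
          ((\<forall>x. jac P x = 0) \<or>
           (\<exists>x. jac P x = 0 \<and> frechet_derivative P (at x) \<noteq> (\<lambda>h. 0))) \<and>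
          \<not> quasiregular P) \<and>
     (\<forall>a c. a * c \<noteq> 0 \<longrightarrow>
        \<not> inj (harm_cubic a c :: real ^ ('d option) \<Rightarrow> real ^ ('d option)))"
  unfolding assms(1,3)
proof (intro conjI)
  have d: "CARD('d) \<ge> 2" using assms(1,2) by simp
  show "\<forall>P :: real ^ ('d option) \<Rightarrow> real ^ ('d option).
      equivariant P \<and> homogeneous_cubic P \<longrightarrow> (\<exists>a b c e. P = equiv_cubic a b c e)"
    using equivariant_cubic_form by blast
  show "\<forall>a b c e. harmonic_map (equiv_cubic a b c e :: real ^ ('d option) \<Rightarrow> real ^ ('d option)) \<longleftrightarrow>
      a + (real CARD('d) + 2) * b = 0 \<and> 3 * c + real CARD('d) * e = 0"
    by (intro allI harmonic_equiv_cubic_iff)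
  show "\<forall>P :: real ^ ('d option) \<Rightarrow> real ^ ('d option). eqv_harm_cubic P \<longrightarrow> (\<exists>a c. P = harm_cubic a c)"
    by (intro allI impI eqv_harm_cubic_form)
  show "\<forall>P :: real ^ ('d option) \<Rightarrow> real ^ ('d option).
      eqv_harm_cubic P \<and> P \<noteq> (\<lambda>x. 0) \<longrightarrow> \<not> (\<forall>x \<in> sphere 0 1. jac P x > 0)"
  proof (intro allI impI)
    fix P :: "real ^ ('d option) \<Rightarrow> real ^ ('d option)"
    assume "eqv_harm_cubic P \<and> P \<noteq> (\<lambda>x. 0)"
    then obtain a c where "P = harm_cubic a c" using eqv_harm_cubic_form by blast
    then show "\<not> (\<forall>x \<in> sphere 0 1. jac P x > 0)"
      using sphere_cone_point[OF d, of a c] by force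
  qed
  show "\<forall>a c. odd (CARD('d) + 1) \<and> a * c \<noteq> 0 \<longrightarrow>
      (\<exists>x \<in> sphere (0 :: real ^ ('d option)) 1. jac (harm_cubic a c) x > 0) \<and>
      (\<exists>x \<in> sphere (0 :: real ^ ('d option)) 1. jac (harm_cubic a c) x < 0)"
    using jac_harm_cubic_changes_sign by auto
  show "\<forall>a c. even (CARD('d) + 1) \<and> a ^ CARD('d) * c > 0 \<longrightarrow>
        (\<forall>x :: real ^ ('d option). jac (harm_cubic a c) x \<ge> 0) \<and>
        {x \<in> sphere (0 :: real ^ ('d option)) 1. jac (harm_cubic a c) x = 0} =
          {join y t | y t. (norm y)\<^sup>2 = (real CARD('d) + 2) * t\<^sup>2 \<and> (norm y)\<^sup>2 + t\<^sup>2 = 1} \<and>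
        {x \<in> sphere (0 :: real ^ ('d option)) 1. jac (harm_cubic a c) x = 0} =
          {x \<in> sphere 0 1. tcoord x = 1 / sqrt (real CARD('d) + 3)} \<union>
          {x \<in> sphere 0 1. tcoord x = - 1 / sqrt (real CARD('d) + 3)}"
  proof (intro allI impI)
    fix a c :: real
    assume ac: "even (CARD('d) + 1) \<and> a ^ CARD('d) * c > 0"
    let ?Z = "{x \<in> sphere (0 :: real ^ ('d option)) 1. jac (harm_cubic a c) x = 0}"
    have Q: "a ^ CARD('d) * c \<noteq> 0" using ac by linarith
    have nonzero: "x \<noteq> 0" if "x \<in> sphere 0 1" for x :: "real ^ ('d option)"
      using that by auto
    have Z: "?Z = {x \<in> sphere 0 1. (norm (ycoord x))\<^sup>2 = (real CARD('d) + 2) * (tcoord x)\<^sup>2}"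
      using jac_harm_cubic_eq_0_iff[OF Q d nonzero] by blast
    have sph: "x \<in> sphere 0 1 \<longleftrightarrow> (norm (ycoord x))\<^sup>2 + (tcoord x)\<^sup>2 = 1" for x :: "real ^ ('d option)"
      using norm_join[of "ycoord x" "tcoord x"] by (auto simp: power2_eq_1_iff) (smt (verit) norm_ge_zero)
    have "?Z = {join y t | y t. (norm y)\<^sup>2 = (real CARD('d) + 2) * t\<^sup>2 \<and> (norm y)\<^sup>2 + t\<^sup>2 = 1}"
    proof (intro set_eqI iffI)
      fix x assume "x \<in> ?Z"
      then have "(norm (ycoord x))\<^sup>2 = (real CARD('d) + 2) * (tcoord x)\<^sup>2" "x \<in> sphere 0 1"
        unfolding Z by blast+
      then show "x \<in> {join y t | y t. (norm y)\<^sup>2 = (real CARD('d) + 2) * t\<^sup>2 \<and> (norm y)\<^sup>2 + t\<^sup>2 = 1}"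
        unfolding sph mem_Collect_eq by (intro exI[of _ "ycoord x"] exI[of _ "tcoord x"]) simp
    next
      fix x :: "real ^ ('d option)"
      assume "x \<in> {join y t | y t. (norm y)\<^sup>2 = (real CARD('d) + 2) * t\<^sup>2 \<and> (norm y)\<^sup>2 + t\<^sup>2 = 1}"
      then show "x \<in> ?Z" unfolding sph by (auto simp: harm_cubic_on_cone(2) d)
    qed
    moreover have "?Z = {x \<in> sphere 0 1. tcoord x = 1 / sqrt (real CARD('d) + 3)} \<union>
        {x \<in> sphere 0 1. tcoord x = - 1 / sqrt (real CARD('d) + 3)}"
      unfolding Z using sphere_latitude_iff by blast
    moreover have "\<forall>x :: real ^ ('d option). jac (harm_cubic a c) x \<ge> 0"
      using ac by (intro allI jac_harm_cubic_nonneg) auto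
    ultimately show "(\<forall>x :: real ^ ('d option). jac (harm_cubic a c) x \<ge> 0) \<and>
        ?Z = {join y t | y t. (norm y)\<^sup>2 = (real CARD('d) + 2) * t\<^sup>2 \<and> (norm y)\<^sup>2 + t\<^sup>2 = 1} \<and>
        ?Z = {x \<in> sphere 0 1. tcoord x = 1 / sqrt (real CARD('d) + 3)} \<union>
          {x \<in> sphere 0 1. tcoord x = - 1 / sqrt (real CARD('d) + 3)}"
      by blast
  qed
  show "\<forall>P :: real ^ ('d option) \<Rightarrow> real ^ ('d option).
        eqv_harm_cubic P \<and> P \<noteq> (\<lambda>x. 0) \<longrightarrow>
          ((\<forall>x. jac P x = 0) \<or>
           (\<exists>x. jac P x = 0 \<and> frechet_derivative P (at x) \<noteq> (\<lambda>h. 0))) \<and>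
          \<not> quasiregular P"
  proof (intro allI impI)
    fix P :: "real ^ ('d option) \<Rightarrow> real ^ ('d option)"
    assume P: "eqv_harm_cubic P \<and> P \<noteq> (\<lambda>x. 0)"
    then obtain a c where ac: "P = harm_cubic a c" using eqv_harm_cubic_form by blast
    obtain x where x: "jac P x = 0" "P x \<noteq> 0"
      using harm_cubic_critical_point[of a c] P d unfolding ac by blast
    have "frechet_derivative P (at x) \<noteq> (\<lambda>h. 0)"
      using x(2) unfolding ac harm_cubic_eq_equiv_cubic by (rule equiv_cubic_derivative_nonzero)
    moreover from this have "\<not> quasiregular P"
      using x(1) by (intro not_quasiregular_critical_point[of P x])
        (auto simp only: ac harm_cubic_eq_equiv_cubic Ck_equiv_cubic)
    ultimately show "((\<forall>x. jac P x = 0) \<or>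
        (\<exists>x. jac P x = 0 \<and> frechet_derivative P (at x) \<noteq> (\<lambda>h. 0))) \<and> \<not> quasiregular P"
      using x(1) by blast
  qed
  show "\<forall>a c. a * c \<noteq> 0 \<longrightarrow> \<not> inj (harm_cubic a c :: real ^ ('d option) \<Rightarrow> real ^ ('d option))"
    using harm_cubic_not_inj by blast
\<comment> \<open>The goals left over are the Jacobian formula and the positivity of its last
  factor.\<close>
qed (intro allI impI jac_harm_cubic jac_factor_pos)+

end
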